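(* Let the setting and the algorithm RandProx-Minibatch be as in the context. Suppose that $\mu_f>0$ or $\mu_g>0$, that $\mu_{h^*}>0$, and that $0<\gamma<\frac{2}{L_f}$. For $t\ge0$ let $$\Psi^t:=\frac{1}{\gamma}\|x^t-x^\star\|^2+\frac{n}{k}\big(\gamma n+2\mu_{h^*}\big)\sum_{i=1}^n\|u_i^t-u_i^\star\|^2,$$ where $x^\star$ and $(u_i^\star)_{i=1}^n$ are the unique solutions of the primal and dual problems. Then for every $t\ge0$, $\mathbb{E}[\Psi^t]\le c^t\Psi^0$, where $$c:=\max\left(\frac{(1-\gamma\mu_f)^2}{1+\gamma\mu_g},\ \frac{(\gamma L_f-1)^2}{1+\gamma\mu_g},\ 1-\frac{2k\mu_{h^*}}{n(\gamma n+2\mu_{h^*})}\right).$$ Moreover, $(x^t)$ and $(\hat{x}^t)$ both converge to $x^\star$ and $(u_i^t)$ converges to $u_i^\star$ for every $i$, almost surely.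
   Context: $\mathcal{X}$ is a finite-dimensional real Hilbert space, $n\ge2$, $k\in\{1,\dots,n\}$. $f:\mathcal{X}\to\mathbb{R}$ convex and $L_f$-smooth ($\nabla f$ $L_f$-Lipschitz); $g,h_1,\dots,h_n:\mathcal{X}\to\mathbb{R}\cup\{+\infty\}$ proper closed convex. A convex $\phi$ is $\mu_\phi$-strongly convex ($\mu_\phi\ge0$) if $\phi-\frac{\mu_\phi}{2}\|\cdot\|^2$ is convex; $\mu_f,\mu_g\ge0$ are such constants for $f,g$, and every conjugate $h_i^*$ is $\mu_{h^*}$-strongly convex for a common $\mu_{h^*}\ge0$. $\mathrm{prox}_{\gamma\phi}(x):=\arg\min_{x'}(\gamma\phi(x')+\frac12\|x'-x\|^2)$. Primal problem: minimize $f(x)+g(x)+\sum_{i=1}^n h_i(x)$ over $x\in\mathcal{X}$; dual problem: minimize $(f+g)^*\big(-\sum_{i=1}^n u_i\big)+\sum_{i=1}^n h_i^*(u_i)$ over $(u_i)_{i=1}^n\in\mathcal{X}^n$. It is assumed that there exist $x^\star$ and $(u_i^\star)$ with $0\in\nabla f(x^\star)+\partial g(x^\star)+\sum_i u_i^\star$ and $x^\star\in\partial h_i^*(u_i^\star)$ for all $i$. Algorithm RandProx-Minibatch: inputs $x^0\in\mathcal{X}$, $(u_i^0)_{i=1}^n\in\mathcal{X}^n$, $\gamma>0$; $v^0:=\sum_i u_i^0$; for $t\ge0$: $\hat{x}^t:=\mathrm{prox}_{\gamma g}(x^t-\gamma\nabla f(x^t)-\gamma v^t)$; pick $\Omega^t\subset\{1,\dots,n\}$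 of size $k$ uniformly at random (independently of the past); for $i\in\Omega^t$: $u_i^{t+1}:=\mathrm{prox}_{\frac{1}{\gamma n}h_i^*}\big(u_i^t+\frac{1}{\gamma n}\hat{x}^t\big)$; for $i\notin\Omega^t$: $u_i^{t+1}:=u_i^t$; $v^{t+1}:=\sum_i u_i^{t+1}$; $x^{t+1}:=\hat{x}^t-\frac{\gamma n}{k}(v^{t+1}-v^t)$. *)

theory Defs
  imports "HOL-Analysis.Analysis" "HOL-Probability.Probability"
begin

definition proper_fun :: "('a \<Rightarrow> ereal) \<Rightarrow> bool" where
  "proper_fun \<phi> \<longleftrightarrow> (\<forall>x. \<phi> x \<noteq> -\<infinity>) \<and> (\<exists>x. \<phi> x \<noteq> \<infinity>)"

definition closed_fun :: "('a::topological_space \<Rightarrow> ereal) \<Rightarrow> bool" where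
  "closed_fun \<phi> \<longleftrightarrow> closed {(x, r::real). \<phi> x \<le> ereal r}"

definition convex_fun :: "('a::real_vector \<Rightarrow> ereal) \<Rightarrow> bool" where
  "convex_fun \<phi> \<longleftrightarrow> convex {(x, r::real). \<phi> x \<le> ereal r}"

definition strongly_convex_fun :: "real \<Rightarrow> ('a::real_normed_vector \<Rightarrow> ereal) \<Rightarrow> bool" where
  "strongly_convex_fun \<mu> \<phi> \<longleftrightarrow> convex_fun (\<lambda>x. \<phi> x - ereal (\<mu> / 2 * (norm x)\<^sup>2))"

definition conj_fun :: "('a::real_inner \<Rightarrow> ereal) \<Rightarrow> 'a \<Rightarrow> ereal" where
  "conj_fun \<phi> u = (SUP x. ereal (u \<bullet> x) - \<phi> x)"

definition subdiff :: "('a::real_inner \<Rightarrow> ereal) \<Rightarrow> 'a \<Rightarrow> 'a set" where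
  "subdiff \<phi> x = {s. \<phi> x \<noteq> \<infinity> \<and> (\<forall>y. \<phi> x + ereal (s \<bullet> (y - x)) \<le> \<phi> y)}"

definition prox :: "real \<Rightarrow> ('a::real_inner \<Rightarrow> ereal) \<Rightarrow> 'a \<Rightarrow> 'a" where
  "prox \<gamma> \<phi> x = (SOME p. \<forall>y. ereal \<gamma> * \<phi> p + ereal ((norm (p - x))\<^sup>2 / 2)
                                  \<le> ereal \<gamma> * \<phi> y + ereal ((norm (y - x))\<^sup>2 / 2))"

text \<open>Given the sequence of sampled index sets Om (Om t = Omega^t, indices 0..n-1),
  randprox_state ... Om t = (x^t, u^t), where u^t i = u_i^t.\<close>
primrec randprox_state ::
  "('a::real_inner \<Rightarrow> 'a) \<Rightarrow> ('a \<Rightarrow> ereal) \<Rightarrow> (nat \<Rightarrow> 'a \<Rightarrow> ereal) \<Rightarrow> nat \<Rightarrow> nat \<Rightarrow> real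
   \<Rightarrow> 'a \<Rightarrow> (nat \<Rightarrow> 'a) \<Rightarrow> (nat \<Rightarrow> nat set) \<Rightarrow> nat \<Rightarrow> 'a \<times> (nat \<Rightarrow> 'a)" where
  "randprox_state df g h n k \<gamma> x0 u0 Om 0 = (x0, u0)"
| "randprox_state df g h n k \<gamma> x0 u0 Om (Suc t) =
     (let (x, u) = randprox_state df g h n k \<gamma> x0 u0 Om t;
          v = (\<Sum>i<n. u i);
          xh = prox \<gamma> g (x - \<gamma> *\<^sub>R df x - \<gamma> *\<^sub>R v);
          u' = (\<lambda>i. if i \<in> Om t
                     then prox (1 / (\<gamma> * real n)) (conj_fun (h i)) (u i + (1 / (\<gamma> * real n)) *\<^sub>R xh)
                     else u i);
          v' = (\<Sum>i<n. u' i)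
      in (xh - (\<gamma> * real n / real k) *\<^sub>R (v' - v), u'))"

definition randprox_x where
  "randprox_x df g h n k \<gamma> x0 u0 Om t = fst (randprox_state df g h n k \<gamma> x0 u0 Om t)"

definition randprox_u where
  "randprox_u df g h n k \<gamma> x0 u0 Om t = snd (randprox_state df g h n k \<gamma> x0 u0 Om t)"

definition randprox_xhat where
  "randprox_xhat df g h n k \<gamma> x0 u0 Om t =
     (let x = randprox_x df g h n k \<gamma> x0 u0 Om t; u = randprox_u df g h n k \<gamma> x0 u0 Om t
      in prox \<gamma> g (x - \<gamma> *\<^sub>R df x - \<gamma> *\<^sub>R (\<Sum>i<n. u i)))"

definition sampling_space :: "nat \<Rightarrow> nat \<Rightarrow> nat set stream measure" where
  "sampling_space n k = stream_space (measure_pmf (pmf_of_set {S. S \<subseteq> {..<n} \<and> card S = k}))"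

end

theory Submission
  imports Defs
begin

text \<open>
  The Lyapunov function contracts in conditional expectation at every step.  Strong monotonicity
  of \<open>\<partial>g\<close> and \<open>\<partial>h\<^sub>i\<^sup>*\<close>, evaluated at the proximal points and at the KKT point, bounds
  the deterministic part; for the random part the Cauchy--Schwarz inequality
  \<open>\<parallel>\<Sum>\<^sub>S \<delta>\<^sub>i\<parallel>\<^sup>2 \<le> k \<Sum>\<^sub>S \<parallel>\<delta>\<^sub>i\<parallel>\<^sup>2\<close> already makes the bound linear in the
  indicator of \<open>S\<close>, so that only the inclusion probability \<open>k/n\<close> matters, and no pairwise
  correlations.  The gradient step contracts by the Baillon--Haddad inequality.  Since the expected
  values decay geometrically, the Lyapunov values are almost surely summable, which gives the
  pathwise convergence.  Strong convexity identifies the given primal and dual solutions with the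
  KKT point, using \<open>x \<in> \<partial>h\<^sup>*(u) \<Longrightarrow> u \<in> \<partial>h(x)\<close> for closed convex \<open>h\<close>.
\<close>

section \<open>Limits along segments and expansions of squared norms\<close>

text \<open>A negative \<open>a\<close> cannot be compensated by \<open>t * b\<close> for small
  \<open>t\<close>. This replaces the limit t -> 0 after a convexity inequality has been divided by
  \<open>t\<close>.\<close>

lemma nonneg_if_scaled_nonneg_at_0:
  fixes a b :: real
  assumes "\<And>t. 0 < t \<Longrightarrow> t < 1 \<Longrightarrow> 0 \<le> a + t * b"
  shows "0 \<le> a"
proof (rule ccontr)
  assume "\<not> 0 \<le> a"
  then have a: "a < 0" by simp
  \<comment> \<open>The second argument keeps \<open>t * b\<close> at most \<open>- a / 2\<close>,
    so \<open>a + t * b\<close> stays negative; the \<open>+ 1\<close> covers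
    \<open>b = 0\<close>.\<close>
  define t where "t = min (1/2) (- a / (2 * (\<bar>b\<bar> + 1)))"
  have t: "0 < t" "t < 1" using a by (auto simp: t_def intro: divide_neg_pos)
  have "t * b \<le> t * (\<bar>b\<bar> + 1)" using t by (intro mult_left_mono) auto
  also have "\<dots> \<le> (- a / (2 * (\<bar>b\<bar> + 1))) * (\<bar>b\<bar> + 1)"
    by (intro mult_right_mono) (auto simp: t_def)
  also have "\<dots> = - a / 2" by (simp add: field_simps add_nonneg_eq_0_iff)
  finally show False using assms[OF t] a by simp
qed

lemma norm_add_sq: "(norm (a + b :: 'a::real_inner))\<^sup>2 = (norm a)\<^sup>2 + 2 * (a \<bullet> b) + (norm b)\<^sup>2"
  by (simp add: power2_norm_eq_inner inner_add_left inner_add_right inner_commute)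

lemma norm_diff_sq: "(norm (a - b :: 'a::real_inner))\<^sup>2 = (norm a)\<^sup>2 - 2 * (a \<bullet> b) + (norm b)\<^sup>2"
  by (simp add: power2_norm_eq_inner inner_diff_left inner_diff_right inner_commute)

section \<open>Subgradients, proximal points and conjugates\<close>

lemma convex_funD:
  assumes "convex_fun \<phi>" "\<phi> x \<le> ereal a" "\<phi> y \<le> ereal b" "0 \<le> t" "t \<le> 1"
  shows "\<phi> (x + t *\<^sub>R (y - x)) \<le> ereal ((1 - t) * a + t * b)"
proof -
  have "(1 - t) *\<^sub>R (x, a) + t *\<^sub>R (y, b) \<in> {(x, r::real). \<phi> x \<le> ereal r}"
    using assms unfolding convex_fun_def by (intro convexD) auto
  then show ?thesis by (simp add: algebra_simps)
qed

text \<open>Convexity of \<phi> minus its quadratic is used on the segment from \<open>x\<close> to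
  \<open>y\<close>, while the subgradient inequality bounds the intermediate value from below.
  Dividing by \<open>t\<close> and letting t -> 0 leaves the full quadratic gain.\<close>

lemma subdiff_strongly_convex:
  fixes \<phi> :: "'a::real_inner \<Rightarrow> ereal"
  assumes sc: "strongly_convex_fun \<mu> \<phi>" and nm: "\<And>x. \<phi> x \<noteq> -\<infinity>"
    and s: "s \<in> subdiff \<phi> x"
  shows "\<phi> x + ereal (s \<bullet> (y - x) + \<mu> / 2 * (norm (y - x))\<^sup>2) \<le> \<phi> y"
proof (cases "\<phi> y")
  case (real b)
  obtain a where a: "\<phi> x = ereal a"
    using s nm[of x] by (cases "\<phi> x") (auto simp: subdiff_def)
  define d where "d = y - x"
  \<comment> \<open>The term in \<open>t\<close> reflects an identity: the chord of the squared norm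
    lies above its value at x + t d by exactly t (1 - t) ||d||^2.\<close>
  have "0 \<le> (b - a - s \<bullet> d - \<mu>/2 * (norm d)\<^sup>2) + t * (\<mu>/2 * (norm d)\<^sup>2)" if t: "0 < t" "t < 1" for t
  proof -
    have "\<phi> (x + t *\<^sub>R d) - ereal (\<mu> / 2 * (norm (x + t *\<^sub>R d))\<^sup>2)
        \<le> ereal ((1 - t) * (a - \<mu> / 2 * (norm x)\<^sup>2) + t * (b - \<mu> / 2 * (norm y)\<^sup>2))"
      unfolding d_def
      by (rule convex_funD[OF sc[unfolded strongly_convex_fun_def]]) (use a real t in auto)
    moreover have "ereal (a + s \<bullet> (t *\<^sub>R d)) \<le> \<phi> (x + t *\<^sub>R d)"
      using s a by (auto simp: subdiff_def dest!: spec[of _ "x + t *\<^sub>R d"])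
    ultimately have 1: "a + s \<bullet> (t *\<^sub>R d) - \<mu> / 2 * (norm (x + t *\<^sub>R d))\<^sup>2
        \<le> (1 - t) * (a - \<mu> / 2 * (norm x)\<^sup>2) + t * (b - \<mu> / 2 * (norm y)\<^sup>2)"
      by (cases "\<phi> (x + t *\<^sub>R d)") auto
    have y: "y = x + d" by (simp add: d_def)
    have "0 \<le> t * ((b - a - s \<bullet> d - \<mu>/2 * (norm d)\<^sup>2) + t * (\<mu>/2 * (norm d)\<^sup>2))"
      using 1 unfolding y norm_add_sq by (simp add: field_simps power2_eq_square)
    then show ?thesis using t by (simp add: zero_le_mult_iff)
  qed
  from nonneg_if_scaled_nonneg_at_0[OF this] show ?thesis
    by (simp add: a real d_def)
qed (use nm in auto)

text \<open>Adding the previous inequality in both directions cancels the function values and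
  doubles the quadratic.\<close>

lemma subdiff_strongly_monotone:
  fixes \<phi> :: "'a::real_inner \<Rightarrow> ereal"
  assumes sc: "strongly_convex_fun \<mu> \<phi>" and nm: "\<And>x. \<phi> x \<noteq> -\<infinity>"
    and s: "s \<in> subdiff \<phi> x" and s': "s' \<in> subdiff \<phi> y"
  shows "\<mu> * (norm (x - y))\<^sup>2 \<le> (s - s') \<bullet> (x - y)"
proof -
  obtain a where a: "\<phi> x = ereal a"
    using s nm[of x] by (cases "\<phi> x") (auto simp: subdiff_def)
  obtain b where b: "\<phi> y = ereal b"
    using s' nm[of y] by (cases "\<phi> y") (auto simp: subdiff_def)
  show ?thesis
    using subdiff_strongly_convex[OF sc nm s, of y] subdiff_strongly_convex[OF sc nm s', of x]
    by (simp add: a b norm_minus_commute inner_diff_left inner_diff_right)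
qed

section \<open>Existence of proximal points and their optimality condition\<close>

text \<open>\<open>prox\<close> is a choice by \<open>SOME\<close>, so a minimizer has to be shown
  to exist. The search moves to the epigraph, where closedness of \<phi> is closedness of a set and
  the objective becomes the continuous \<open>Q\<close>; the affine minorant with slope
  \<open>s\<close> makes the sublevel set bounded.\<close>

lemma prox_minimizes:
  fixes \<phi> :: "'a::euclidean_space \<Rightarrow> ereal"
  assumes cl: "closed_fun \<phi>" and nm: "\<And>x. \<phi> x \<noteq> -\<infinity>" and \<gamma>: "\<gamma> > 0"
    and s: "s \<in> subdiff \<phi> z"
  shows "ereal \<gamma> * \<phi> (prox \<gamma> \<phi> x) + ereal ((norm (prox \<gamma> \<phi> x - x))\<^sup>2 / 2)
           \<le> ereal \<gamma> * \<phi> y + ereal ((norm (y - x))\<^sup>2 / 2)"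
proof -
  obtain a where a: "\<phi> z = ereal a"
    using s nm[of z] by (cases "\<phi> z") (auto simp: subdiff_def)
  define E where "E = {(y, r::real). \<phi> y \<le> ereal r}"
  define Q where "Q = (\<lambda>(y, r::real). \<gamma> * r + (norm (y - x))\<^sup>2 / 2)"
  define K where "K = E \<inter> {w. Q w \<le> Q (z, a)}"
  have contQ: "continuous_on UNIV Q"
    unfolding Q_def case_prod_beta by (intro continuous_intros) auto
  have "closed K" unfolding K_def E_def
    using cl closed_Collect_le[OF contQ continuous_on_const, of "Q (z, a)"]
    by (auto simp: closed_fun_def)
  moreover have "bounded K"
  proof -
    \<comment> \<open>Completing the square after replacing \<open>r\<close> by the affine minorant
      gives the radius \<open>sqrt C\<close> around \<open>x - \<gamma> *\<^sub>R s\<close>;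
      \<open>R\<close> is the resulting bound on the distance from \<open>z\<close>.\<close>
    define C where "C = 2 * (Q (z, a) - \<gamma> * (a + s \<bullet> (x - z))) + (norm (\<gamma> *\<^sub>R s))\<^sup>2"
    define R where "R = norm (x - \<gamma> *\<^sub>R s - z) + sqrt C"
    have "K \<subseteq> cball (x - \<gamma> *\<^sub>R s) (sqrt C) \<times> {a - norm s * R .. Q (z, a) / \<gamma>}"
    proof (rule subrelI)
      fix y r assume "(y, r) \<in> K"
      then have y: "\<phi> y \<le> ereal r" and q: "\<gamma> * r + (norm (y - x))\<^sup>2 / 2 \<le> Q (z, a)"
        by (auto simp: K_def E_def Q_def)
      have "ereal (a + s \<bullet> (y - z)) \<le> \<phi> y" using s a by (auto simp: subdiff_def)
      with y have "ereal (a + s \<bullet> (y - z)) \<le> ereal r" by (rule order_trans[rotated])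
      then have r: "a + s \<bullet> (y - z) \<le> r" by simp
      then have "\<gamma> * (a + s \<bullet> (y - z)) \<le> \<gamma> * r" using \<gamma> by simp
      then have "(norm ((y - x) + \<gamma> *\<^sub>R s))\<^sup>2 \<le> C"
        using q unfolding C_def norm_add_sq by (simp add: algebra_simps inner_commute)
      then have n: "norm ((y - x) + \<gamma> *\<^sub>R s) \<le> sqrt C" by (rule real_le_rsqrt)
      then have d: "y \<in> cball (x - \<gamma> *\<^sub>R s) (sqrt C)"
        using norm_minus_commute[of "x - \<gamma> *\<^sub>R s" y] by (simp add: dist_norm algebra_simps)
      have "norm (y - z) \<le> R"
        using norm_triangle_ineq[of "x - \<gamma> *\<^sub>R s - z" "(y - x) + \<gamma> *\<^sub>R s"] n
        by (simp add: R_def)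
      then have "\<bar>s \<bullet> (y - z)\<bar> \<le> norm s * R"
        using Cauchy_Schwarz_ineq2[of s "y - z"] by (meson mult_left_mono norm_ge_zero order_trans)
      then have "a - norm s * R \<le> r" using r by linarith
      moreover have "\<gamma> * r \<le> Q (z, a)" using q zero_le_power2[of "norm (y - x)"] by linarith
      then have "r \<le> Q (z, a) / \<gamma>" using \<gamma> by (simp add: field_simps)
      ultimately show "(y, r) \<in> cball (x - \<gamma> *\<^sub>R s) (sqrt C) \<times> {a - norm s * R .. Q (z, a) / \<gamma>}"
        using d by auto
    qed
    then show ?thesis by (rule bounded_subset[rotated]) (intro bounded_Times bounded_cball bounded_closed_interval)
  qed
  ultimately have K: "compact K" by (simp add: compact_eq_bounded_closed)
  have za: "(z, a) \<in> K" by (auto simp: K_def E_def a)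
  have "continuous_on K Q" by (rule continuous_on_subset[OF contQ]) simp
  then obtain w where w: "w \<in> K" "\<forall>w'\<in>K. Q w \<le> Q w'"
    using continuous_attains_inf[OF K] za by blast
  obtain p r where pr_eq: "w = (p, r)" by (cases w)
  have pr: "(p, r) \<in> K" and min: "\<And>w. w \<in> K \<Longrightarrow> Q (p, r) \<le> Q w"
    using w by (auto simp: pr_eq)
  have "\<exists>p. \<forall>y. ereal \<gamma> * \<phi> p + ereal ((norm (p - x))\<^sup>2 / 2)
                 \<le> ereal \<gamma> * \<phi> y + ereal ((norm (y - x))\<^sup>2 / 2)"
  proof (intro exI allI)
    fix y
    have p: "\<phi> p \<le> ereal r" using pr by (auto simp: K_def E_def)
    obtain p' where p': "\<phi> p = ereal p'" "p' \<le> r" using p nm[of p] by (cases "\<phi> p") auto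
    show "ereal \<gamma> * \<phi> p + ereal ((norm (p - x))\<^sup>2 / 2) \<le> ereal \<gamma> * \<phi> y + ereal ((norm (y - x))\<^sup>2 / 2)"
    proof (cases "\<phi> y")
      case (real b)
      have "Q (p, r) \<le> Q (y, b)"
      \<comment> \<open>Outside the sublevel set \<open>Q\<close> exceeds its value at
        \<open>(z, a)\<close>, which is already at least the minimum over \<open>K\<close>.\<close>
      proof (cases "Q (y, b) \<le> Q (z, a)")
        case True then show ?thesis using real by (intro min) (auto simp: K_def E_def)
      next
        case False then show ?thesis using min[OF za] by simp
      qed
      moreover have "\<gamma> * p' \<le> \<gamma> * r" using p' \<gamma> by simp
      ultimately show ?thesis using real p' by (simp add: Q_def)
    qed (use nm \<gamma> in auto)
  qed
  then show ?thesis unfolding prox_def by (rule someI2_ex) blast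
qed

text \<open>A move by the fraction \<open>t\<close> from the minimizer towards \<open>y\<close>
  cannot lower the objective; convexity bounds \<phi> there, and dividing by \<open>t\<close> leaves
  the first-order condition. The subgradient at \<open>z\<close> secures existence of the minimizer;
  later the KKT point supplies it.\<close>

lemma prox_subdiff:
  fixes \<phi> :: "'a::euclidean_space \<Rightarrow> ereal"
  assumes cl: "closed_fun \<phi>" and cv: "convex_fun \<phi>" and nm: "\<And>x. \<phi> x \<noteq> -\<infinity>" and \<gamma>: "\<gamma> > 0"
    and s: "s \<in> subdiff \<phi> z"
  shows "(1 / \<gamma>) *\<^sub>R (x - prox \<gamma> \<phi> x) \<in> subdiff \<phi> (prox \<gamma> \<phi> x)"
proof -
  define p where "p = prox \<gamma> \<phi> x"
  note min = prox_minimizes[OF cl nm \<gamma> s, of x, folded p_def]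
  obtain a where a: "\<phi> z = ereal a"
    using s nm[of z] by (cases "\<phi> z") (auto simp: subdiff_def)
  obtain b where b: "\<phi> p = ereal b"
    using min[of z] a \<gamma> nm[of p] by (cases "\<phi> p") auto
  have "\<phi> p + ereal (((1 / \<gamma>) *\<^sub>R (x - p)) \<bullet> (y - p)) \<le> \<phi> y" for y
  proof (cases "\<phi> y")
    case (real c)
    define d where "d = y - p"
    have "0 \<le> (\<gamma> * (c - b) - (x - p) \<bullet> d) + t * ((norm d)\<^sup>2 / 2)" if t: "0 < t" "t < 1" for t
    proof -
      have "\<phi> (p + t *\<^sub>R d) \<le> ereal ((1 - t) * b + t * c)"
        unfolding d_def by (rule convex_funD[OF cv]) (use b real t in auto)
      then obtain e where e: "\<phi> (p + t *\<^sub>R d) = ereal e" "e \<le> (1 - t) * b + t * c"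
        using nm[of "p + t *\<^sub>R d"] by (cases "\<phi> (p + t *\<^sub>R d)") auto
      have "\<gamma> * b + (norm (p - x))\<^sup>2 / 2 \<le> \<gamma> * e + (norm ((p - x) + t *\<^sub>R d))\<^sup>2 / 2"
        using min[of "p + t *\<^sub>R d"] b e(1) by (simp add: algebra_simps)
      moreover have "\<gamma> * e \<le> \<gamma> * ((1 - t) * b + t * c)" using e \<gamma> by simp
      ultimately have "0 \<le> t * ((\<gamma> * (c - b) - (x - p) \<bullet> d) + t * ((norm d)\<^sup>2 / 2))"
        unfolding norm_add_sq by (simp add: field_simps power2_eq_square inner_diff_left)
      then show ?thesis using t by (simp add: zero_le_mult_iff)
    qed
    from nonneg_if_scaled_nonneg_at_0[OF this] have "(x - p) \<bullet> d \<le> \<gamma> * (c - b)" by simp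
    then have "(1 / \<gamma>) * ((x - p) \<bullet> d) \<le> c - b" using \<gamma> by (simp add: field_simps)
    then show ?thesis by (simp add: b real d_def)
  qed (use nm in auto)
  then show ?thesis using b unfolding subdiff_def p_def by auto
qed

section \<open>Convex conjugates: the Fenchel--Young inequality and its equality case\<close>

lemma conj_fun_ge: "ereal (u \<bullet> x) - \<phi> x \<le> conj_fun \<phi> u"
  unfolding conj_fun_def by (rule SUP_upper) simp

lemma conj_fun_le_iff: "conj_fun \<phi> u \<le> c \<longleftrightarrow> (\<forall>x. ereal (u \<bullet> x) - \<phi> x \<le> c)"
  unfolding conj_fun_def by (auto simp: SUP_le_iff)

lemma conj_fun_not_MInf:
  assumes "proper_fun \<phi>"
  shows "conj_fun \<phi> u \<noteq> -\<infinity>"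
proof -
  obtain x a where "\<phi> x = ereal a"
    using assms unfolding proper_fun_def by (metis ereal_cases)
  then show ?thesis using conj_fun_ge[of u x \<phi>] by auto
qed

text \<open>Each point of the effective domain contributes one closed half-space, and points with
  \<phi> infinite impose no constraint. Closedness and convexity of the conjugate can then be read
  off.\<close>

lemma epigraph_conj_fun:
  assumes "proper_fun \<phi>"
  shows "{(u, r::real). conj_fun \<phi> u \<le> ereal r}
    = (\<Inter>x\<in>{x. \<phi> x \<noteq> \<infinity>}. {w. (x, -1) \<bullet> w \<le> real_of_ereal (\<phi> x)})"
proof -
  have "ereal (u \<bullet> x) - \<phi> x \<le> ereal r \<longleftrightarrow> (\<phi> x \<noteq> \<infinity> \<longrightarrow> x \<bullet> u - r \<le> real_of_ereal (\<phi> x))" for u x r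
    using assms unfolding proper_fun_def by (cases "\<phi> x") (auto simp: inner_commute)
  then show ?thesis by (auto simp: conj_fun_le_iff)
qed

lemma closed_conj_fun: "proper_fun \<phi> \<Longrightarrow> closed_fun (conj_fun \<phi>)"
  unfolding closed_fun_def by (subst epigraph_conj_fun) (auto intro: closed_INT closed_halfspace_le)

lemma convex_conj_fun: "proper_fun \<phi> \<Longrightarrow> convex_fun (conj_fun \<phi>)"
  unfolding convex_fun_def by (subst epigraph_conj_fun) (auto intro: convex_INT convex_halfspace_le)

text \<open>The equality case of Fenchel--Young, in place of the full biconjugate theorem. If the
  required point lay outside the closed convex epigraph of \<phi>, a separating hyperplane would
  give a slope at which the subgradient inequality of the conjugate fails.\<close>

lemma subdiff_conj_fun_eq:
  fixes \<phi> :: "'a::euclidean_space \<Rightarrow> ereal"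
  assumes pr: "proper_fun \<phi>" and cl: "closed_fun \<phi>" and cv: "convex_fun \<phi>"
    and x: "x \<in> subdiff (conj_fun \<phi>) u"
  obtains a where "\<phi> x = ereal a" "conj_fun \<phi> u = ereal (u \<bullet> x - a)"
proof -
  have nm: "\<phi> y \<noteq> -\<infinity>" for y using pr by (auto simp: proper_fun_def)
  obtain q where q: "conj_fun \<phi> u = ereal q"
    using conj_fun_not_MInf[OF pr, of u] x by (cases "conj_fun \<phi> u") (auto simp: subdiff_def)
  have xsub: "ereal (q + x \<bullet> (u' - u)) \<le> conj_fun \<phi> u'" for u'
    using x q by (auto simp: subdiff_def)
  define E where "E = {(y, r::real). \<phi> y \<le> ereal r}"
  define r0 where "r0 = u \<bullet> x - q"
  have "(x, r0) \<in> E"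
  proof (rule ccontr)
    assume "(x, r0) \<notin> E"
    then obtain ab \<beta> where sep: "ab \<bullet> (x, r0) < \<beta>" "\<And>w. w \<in> E \<Longrightarrow> \<beta> < ab \<bullet> w"
      using separating_hyperplane_closed_point[of E "(x, r0)"] cl cv
      unfolding E_def closed_fun_def convex_fun_def by blast
    obtain a b where ab: "ab = (a, b)" by (cases ab)
    have sep1: "a \<bullet> x + b * r0 < \<beta>" using sep(1) by (simp add: ab)
    have sep2: "\<beta> < a \<bullet> y + b * r" if "\<phi> y \<le> ereal r" for y r
      using sep(2)[of "(y, r)"] that by (simp add: ab E_def)
    obtain y0 c0 where y0: "\<phi> y0 = ereal c0"
      using pr unfolding proper_fun_def by (metis ereal_cases)
    \<comment> \<open>The epigraph is unbounded upwards, so a negative \<open>b\<close> would push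
      the functional below the separating level.\<close>
    have b: "b \<ge> 0"
    proof (rule ccontr)
      assume "\<not> b \<ge> 0"
      then have b: "b < 0" by simp
      define r where "r = max c0 ((\<beta> - a \<bullet> y0) / b)"
      have "b * r \<le> b * ((\<beta> - a \<bullet> y0) / b)" using b by (intro mult_left_mono_neg) (auto simp: r_def)
      then show False using sep2[of y0 r] b y0 by (simp add: r_def)
    qed
    show False
    proof (cases "b = 0")
      case True
      \<comment> \<open>For a vertical hyperplane, tilting \<open>u\<close> by \<open>- a\<close>
        lowers the conjugate by at least \<beta>, whereas the subgradient \<open>x\<close> allows a
        drop of at most \<open>a \<bullet> x\<close>, which is below \<beta>.\<close>
      have "conj_fun \<phi> (u - a) \<le> ereal (q - \<beta>)"
        unfolding conj_fun_le_iff
      proof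
        fix y show "ereal ((u - a) \<bullet> y) - \<phi> y \<le> ereal (q - \<beta>)"
        proof (cases "\<phi> y")
          case (real c)
          then show ?thesis using sep2[of y c] conj_fun_ge[of u y \<phi>] True q
            by (simp add: inner_diff_left)
        qed (use nm in auto)
      qed
      from order_trans[OF xsub this] sep1 True show False
        by (simp add: inner_commute)
    next
      case False
      with b have b: "b > 0" by simp
      \<comment> \<open>A non-vertical hyperplane is the graph of an affine minorant of \<phi>; its
        slope is the competitor.\<close>
      have "conj_fun \<phi> (- (1 / b) *\<^sub>R a) \<le> ereal (- \<beta> / b)"
        unfolding conj_fun_le_iff
      proof
        fix y show "ereal ((- (1 / b) *\<^sub>R a) \<bullet> y) - \<phi> y \<le> ereal (- \<beta> / b)"
        proof (cases "\<phi> y")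
          case (real c)
          then have "\<beta> / b < (a \<bullet> y + b * c) / b" using sep2[of y c] b by (intro divide_strict_right_mono) auto
          then show ?thesis using real b by (simp add: add_divide_distrib)
        qed (use nm in auto)
      qed
      from order_trans[OF xsub this]
      have "q + x \<bullet> (- (1 / b) *\<^sub>R a - u) \<le> - \<beta> / b" by simp
      then have "b * (q + x \<bullet> (- (1 / b) *\<^sub>R a - u)) \<le> - \<beta>" using b by (simp add: field_simps)
      then show False using sep1 b by (simp add: r0_def algebra_simps inner_commute)
    qed
  qed
  then have "\<phi> x \<le> ereal r0" by (simp add: E_def)
  then obtain a where a: "\<phi> x = ereal a" "a \<le> r0" using nm[of x] by (cases "\<phi> x") auto
  moreover have "u \<bullet> x - a \<le> q" using conj_fun_ge[of u x \<phi>] a q by simp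
  ultimately show ?thesis using that[of a] q by (simp add: r0_def)
qed

text \<open>Subtracting Fenchel--Young at \<open>y\<close> from its equality case at
  \<open>x\<close> gives the inversion. It turns the dual KKT inclusions into affine minorants of
  the \<open>h i\<close>.\<close>

lemma subdiff_conj_funD:
  fixes \<phi> :: "'a::euclidean_space \<Rightarrow> ereal"
  assumes pcc: "proper_fun \<phi>" "closed_fun \<phi>" "convex_fun \<phi>"
    and x: "x \<in> subdiff (conj_fun \<phi>) u"
  shows "u \<in> subdiff \<phi> x"
proof -
  obtain a where a: "\<phi> x = ereal a" "conj_fun \<phi> u = ereal (u \<bullet> x - a)"
    by (rule subdiff_conj_fun_eq[OF assms])
  have "\<phi> x + ereal (u \<bullet> (y - x)) \<le> \<phi> y" for y
    using conj_fun_ge[of u y \<phi>] a pcc(1)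
    by (cases "\<phi> y") (auto simp: proper_fun_def inner_diff_right)
  then show ?thesis using a by (auto simp: subdiff_def)
qed

section \<open>Contraction of the gradient step\<close>

lemma has_real_derivative_along_line:
  fixes f :: "'a::real_inner \<Rightarrow> real"
  assumes "\<And>x. (f has_derivative (\<lambda>d. df x \<bullet> d)) (at x)"
  shows "((\<lambda>t. f (x + t *\<^sub>R d)) has_real_derivative df (x + t *\<^sub>R d) \<bullet> d) (at t)"
  unfolding has_field_derivative_def
  by (rule has_derivative_eq_rhs[OF has_derivative_compose[OF _ assms]])
     (auto intro!: derivative_eq_intros)

text \<open>Restriction to the line through \<open>x\<close> and \<open>y\<close>, with the
  quadratic subtracted, reduces this to the tangent inequality in one variable.\<close>

lemma gradient_above_tangent:
  fixes f :: "'a::real_inner \<Rightarrow> real"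
  assumes cv: "convex_on UNIV (\<lambda>x. f x - \<mu> / 2 * (norm x)\<^sup>2)"
    and df: "\<And>x. (f has_derivative (\<lambda>d. df x \<bullet> d)) (at x)"
  shows "f x + df x \<bullet> (y - x) + \<mu> / 2 * (norm (y - x))\<^sup>2 \<le> f y"
proof -
  define d where "d = y - x"
  define \<psi> where "\<psi> t = f (x + t *\<^sub>R d) - \<mu> / 2 * (norm (x + t *\<^sub>R d))\<^sup>2" for t
  have "convex_on UNIV \<psi>"
  proof (rule convex_onI)
    fix t a b :: real assume t: "0 < t" "t < 1"
    have e: "x + ((1 - t) *\<^sub>R a + t *\<^sub>R b) *\<^sub>R d = (1 - t) *\<^sub>R (x + a *\<^sub>R d) + t *\<^sub>R (x + b *\<^sub>R d)"
      by (simp add: algebra_simps)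
    show "\<psi> ((1 - t) *\<^sub>R a + t *\<^sub>R b) \<le> (1 - t) * \<psi> a + t * \<psi> b"
      unfolding \<psi>_def e using t by (intro convex_onD[OF cv]) auto
  qed simp
  moreover have "(\<psi> has_real_derivative df x \<bullet> d - \<mu> * (x \<bullet> d)) (at 0)"
    unfolding \<psi>_def norm_add_sq power_mult_distrib norm_scaleR
    by (auto intro!: derivative_eq_intros has_real_derivative_along_line[OF df, of x d 0, simplified])
  ultimately have "(df x \<bullet> d - \<mu> * (x \<bullet> d)) * (1 - 0) \<le> \<psi> 1 - \<psi> 0"
    by (intro convex_on_imp_above_tangent[of UNIV]) auto
  moreover have y: "y = x + d" by (simp add: d_def)
  ultimately show ?thesis unfolding y \<psi>_def
    by (simp add: norm_add_sq field_simps inner_commute[of d x])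
qed

lemma gradient_descent_bound:
  fixes f :: "'a::real_inner \<Rightarrow> real"
  assumes df: "\<And>x. (f has_derivative (\<lambda>d. df x \<bullet> d)) (at x)"
    and lip: "\<And>x y. norm (df x - df y) \<le> L * norm (x - y)"
  shows "f y \<le> f x + df x \<bullet> (y - x) + L / 2 * (norm (y - x))\<^sup>2"
proof -
  define d where "d = y - x"
  \<comment> \<open>The claimed bound is subtracted along the segment, so the descent lemma becomes
    \<psi> 1 \<le> \<psi> 0; the Lipschitz bound makes the derivative nonpositive.\<close>
  define \<psi> where "\<psi> t = f (x + t *\<^sub>R d) - t * (df x \<bullet> d) - L / 2 * (norm d)\<^sup>2 * t\<^sup>2" for t
  have "\<exists>y. (\<psi> has_real_derivative y) (at t) \<and> y \<le> 0" if t: "0 \<le> t" "t \<le> 1" for t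
  proof (intro exI conjI)
    show "(\<psi> has_real_derivative df (x + t *\<^sub>R d) \<bullet> d - df x \<bullet> d - L * (norm d)\<^sup>2 * t) (at t)"
      unfolding \<psi>_def by (auto intro!: derivative_eq_intros has_real_derivative_along_line[OF df])
    have "(df (x + t *\<^sub>R d) - df x) \<bullet> d \<le> norm (df (x + t *\<^sub>R d) - df x) * norm d"
      by (rule norm_cauchy_schwarz)
    also have "\<dots> \<le> (L * norm (x + t *\<^sub>R d - x)) * norm d"
      by (intro mult_right_mono lip) auto
    also have "\<dots> = L * (norm d)\<^sup>2 * t" using t by (simp add: power2_eq_square)
    finally show "df (x + t *\<^sub>R d) \<bullet> d - df x \<bullet> d - L * (norm d)\<^sup>2 * t \<le> 0"
      by (simp add: inner_diff_left)
  qed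
  then have "\<psi> 1 \<le> \<psi> 0" by (intro DERIV_nonpos_imp_nonincreasing[of 0 1 \<psi>]) auto
  then show ?thesis by (simp add: \<psi>_def d_def)
qed

lemma strong_convexity_le_smoothness:
  fixes f :: "'a::real_inner \<Rightarrow> real"
  assumes cv: "convex_on UNIV (\<lambda>x. f x - \<mu> / 2 * (norm x)\<^sup>2)"
    and df: "\<And>x. (f has_derivative (\<lambda>d. df x \<bullet> d)) (at x)"
    and lip: "\<And>x y. norm (df x - df y) \<le> L * norm (x - y)"
    and xy: "(x :: 'a) \<noteq> y"
  shows "\<mu> \<le> L"
proof -
  have "\<mu> / 2 * (norm (y - x))\<^sup>2 \<le> L / 2 * (norm (y - x))\<^sup>2"
    using gradient_above_tangent[OF cv df, of x y] gradient_descent_bound[OF df lip, of y x] by linarith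
  then show ?thesis using xy by simp
qed

text \<open>The Baillon--Haddad argument for \<open>f - \<mu>/2 \<parallel>\<cdot>\<parallel>\<^sup>2\<close>, which is convex and
  \<open>(L - \<mu>)\<close>-smooth.  The step size is left free so that the degenerate case
  \<open>L = \<mu>\<close> follows by letting it grow.\<close>

lemma gradient_cocoercive:
  fixes f :: "'a::real_inner \<Rightarrow> real"
  assumes cv: "convex_on UNIV (\<lambda>x. f x - \<mu> / 2 * (norm x)\<^sup>2)"
    and df: "\<And>x. (f has_derivative (\<lambda>d. df x \<bullet> d)) (at x)"
    and lip: "\<And>x y. norm (df x - df y) \<le> L * norm (x - y)"
  defines "e x y \<equiv> df x - df y - \<mu> *\<^sub>R (x - y)"
  shows "(norm (e x y))\<^sup>2 \<le> (L - \<mu>) * (e x y \<bullet> (x - y))"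
proof (cases "x = y")
  case False
  have step: "(2 * s - (L - \<mu>) * s\<^sup>2) * (norm (e x y))\<^sup>2 \<le> e x y \<bullet> (x - y)" for s
  proof -
    \<comment> \<open>At a trial point \<open>z\<close>, a step of size \<open>s\<close> from
      \<open>y\<close> against the shifted gradient difference, the tangent bound from
      \<open>x\<close> lies below the descent bound from \<open>y\<close>.\<close>
    have half: "s * (norm (e x y))\<^sup>2 - (L - \<mu>) / 2 * s\<^sup>2 * (norm (e x y))\<^sup>2
        \<le> f y - f x - df x \<bullet> (y - x) - \<mu> / 2 * (norm (y - x))\<^sup>2" for x y
    proof -
      define a where "a = df y - df x - \<mu> *\<^sub>R (y - x)"
      define d where "d = y - x"
      have y: "y = x + d" and dfy: "df y = df x + \<mu> *\<^sub>R d + a" by (simp_all add: a_def d_def)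
      define z where "z = y - s *\<^sub>R a"
      have 1: "f x + df x \<bullet> (z - x) + \<mu> / 2 * (norm (z - x))\<^sup>2 \<le> f z"
        by (rule gradient_above_tangent[OF cv df])
      have 2: "f z \<le> f y + df y \<bullet> (z - y) + L / 2 * (norm (z - y))\<^sup>2"
        by (rule gradient_descent_bound[OF df lip])
      have zx: "z - x = d - s *\<^sub>R a" and zy: "z - y = - (s *\<^sub>R a)" by (simp_all add: z_def d_def)
      have "a = - e x y" by (simp add: a_def e_def algebra_simps)
      then have n: "(norm (e x y))\<^sup>2 = (norm a)\<^sup>2" by simp
      show ?thesis unfolding n
        using order_trans[OF 1 2] unfolding zx zy norm_diff_sq d_def[symmetric] dfy
        by (simp add: inner_diff_right inner_add_left inner_add_right power2_norm_eq_inner[symmetric]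
            power_mult_distrib field_simps inner_commute)
    qed
    have "e y x = - e x y" by (simp add: e_def algebra_simps)
    then have "norm (e y x) = norm (e x y)" by simp
    \<comment> \<open>Adding both orders of \<open>x\<close> and \<open>y\<close> cancels the values
      of \<open>f\<close>.\<close>
    then have "2 * (s * (norm (e x y))\<^sup>2 - (L - \<mu>) / 2 * s\<^sup>2 * (norm (e x y))\<^sup>2)
        \<le> df x \<bullet> (x - y) - df y \<bullet> (x - y) - \<mu> * (norm (x - y))\<^sup>2"
      using half[of x y] half[of y x]
      by (simp add: norm_minus_commute[of y x] inner_diff_right)
    also have "\<dots> = e x y \<bullet> (x - y)"
      by (simp add: e_def inner_diff_left[of _ _ "x - y"] power2_norm_eq_inner)
    finally show ?thesis by (simp add: field_simps)
  qed
  have "\<mu> \<le> L" by (rule strong_convexity_le_smoothness[OF cv df lip False])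
  then consider "L - \<mu> > 0" | "L = \<mu>" by linarith
  then show ?thesis
  proof cases
    case 1
    \<comment> \<open>This step size maximizes 2 s - (L - \<mu>) s^2.\<close>
    have "2 * (1 / (L - \<mu>)) - (L - \<mu>) * (1 / (L - \<mu>))\<^sup>2 = 1 / (L - \<mu>)"
      using 1 by (simp add: power2_eq_square)
    then have "(norm (e x y))\<^sup>2 / (L - \<mu>) \<le> e x y \<bullet> (x - y)" using step[of "1 / (L - \<mu>)"] by simp
    then show ?thesis using 1 by (simp add: pos_divide_le_eq mult.commute)
  next
    case 2
    have "norm (e x y) = 0"
    proof (rule ccontr)
      assume "norm (e x y) \<noteq> 0"
      \<comment> \<open>With L = \<mu> the bound is linear in \<open>s\<close>; this choice makes
        its left side exceed the right side by one.\<close>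
      then show False
        using step[of "(e x y \<bullet> (x - y) + 1) / (2 * (norm (e x y))\<^sup>2)"] 2 by simp
    qed
    then show ?thesis using 2 by simp
  qed
qed (simp add: e_def)

text \<open>Cocoercivity places the gradient difference in a ball of radius (L - \<mu>)/2 ||d||
  around (L + \<mu>)/2 d. The triangle inequality for centre and deviation then yields the
  factor.\<close>

lemma gradient_step_contraction:
  fixes f :: "'a::real_inner \<Rightarrow> real"
  assumes cv: "convex_on UNIV (\<lambda>x. f x - \<mu> / 2 * (norm x)\<^sup>2)"
    and df: "\<And>x. (f has_derivative (\<lambda>d. df x \<bullet> d)) (at x)"
    and lip: "\<And>x y. norm (df x - df y) \<le> L * norm (x - y)"
    and \<gamma>: "\<gamma> \<ge> 0"
  shows "(norm ((x - \<gamma> *\<^sub>R df x) - (y - \<gamma> *\<^sub>R df y)))\<^sup>2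
           \<le> max ((1 - \<gamma> * \<mu>)\<^sup>2) ((\<gamma> * L - 1)\<^sup>2) * (norm (x - y))\<^sup>2"
proof (cases "x = y")
  case False
  define d where "d = x - y"
  define p where "p = df x - df y"
  define q where "q = p - ((L + \<mu>) / 2) *\<^sub>R d"
  have le: "\<mu> \<le> L" by (rule strong_convexity_le_smoothness[OF cv df lip False])
  have "(norm (p - \<mu> *\<^sub>R d))\<^sup>2 \<le> (L - \<mu>) * ((p - \<mu> *\<^sub>R d) \<bullet> d)"
    using gradient_cocoercive[OF cv df lip, of x y] by (simp add: p_def d_def)
  moreover have "p - \<mu> *\<^sub>R d = q + ((L - \<mu>) / 2) *\<^sub>R d"
    by (simp add: q_def algebra_simps flip: scaleR_add_left) (simp add: field_simps)
  ultimately have "(norm q)\<^sup>2 \<le> ((L - \<mu>) / 2 * norm d)\<^sup>2"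
    by (simp add: norm_add_sq inner_add_left power_mult_distrib power2_norm_eq_inner[symmetric])
       (simp add: field_simps power2_eq_square)
  then have q: "norm q \<le> (L - \<mu>) / 2 * norm d"
    by (rule power2_le_imp_le) (use le in auto)
  define m where "m = \<bar>1 - \<gamma> * (L + \<mu>) / 2\<bar> + \<gamma> * (L - \<mu>) / 2"
  have "(x - \<gamma> *\<^sub>R df x) - (y - \<gamma> *\<^sub>R df y) = (1 - \<gamma> * (L + \<mu>) / 2) *\<^sub>R d - \<gamma> *\<^sub>R q"
    by (simp add: q_def scaleR_diff_left scaleR_diff_right) (simp add: p_def d_def scaleR_diff_right)
  also have "norm \<dots> \<le> \<bar>1 - \<gamma> * (L + \<mu>) / 2\<bar> * norm d + \<gamma> * norm q"
    using norm_triangle_ineq4[of "(1 - \<gamma> * (L + \<mu>) / 2) *\<^sub>R d" "\<gamma> *\<^sub>R q"] \<gamma> by simp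
  also have "\<dots> \<le> m * norm d"
    using mult_left_mono[OF q \<gamma>] by (simp add: m_def algebra_simps)
  finally have "(norm ((x - \<gamma> *\<^sub>R df x) - (y - \<gamma> *\<^sub>R df y)))\<^sup>2 \<le> (m * norm d)\<^sup>2"
    by (intro power_mono) auto
  also have "m\<^sup>2 \<le> max ((1 - \<gamma> * \<mu>)\<^sup>2) ((\<gamma> * L - 1)\<^sup>2)"
  proof -
    \<comment> \<open>The sign inside the absolute value decides which of the two extreme curvatures
      is met.\<close>
    have "m = 1 - \<gamma> * \<mu> \<or> m = \<gamma> * L - 1" by (auto simp: m_def abs_if field_simps)
    then show ?thesis by auto
  qed
  then have "(m * norm d)\<^sup>2 \<le> max ((1 - \<gamma> * \<mu>)\<^sup>2) ((\<gamma> * L - 1)\<^sup>2) * (norm d)\<^sup>2"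
    by (simp add: power_mult_distrib mult_right_mono)
  finally show ?thesis by (simp add: d_def)
qed simp

section \<open>One step of the algorithm\<close>

text \<open>Double counting: after swapping the sums, each index lies in the fraction k/n of all
  \<open>k\<close>-subsets.\<close>

lemma sum_over_k_subsets:
  fixes a :: "nat \<Rightarrow> real"
  assumes k: "1 \<le> k" "k \<le> n"
  defines "\<S> \<equiv> {S. S \<subseteq> {..<n} \<and> card S = k}"
  shows "(\<Sum>S\<in>\<S>. \<Sum>i\<in>S. a i) = real (card \<S>) * (real k / real n * (\<Sum>i<n. a i))"
proof -
  have fin: "finite \<S>" unfolding \<S>_def by (rule finite_subset[of _ "Pow {..<n}"]) auto
  have cardS: "card \<S> = n choose k" unfolding \<S>_def by (subst n_subsets) auto
  have cnt: "real (card {S\<in>\<S>. i \<in> S}) = real (card \<S>) * (real k / real n)" if i: "i < n" for i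
  proof -
    \<comment> \<open>Sets avoiding \<open>i\<close> are easier to count; Pascal's rule then gives
      those containing it.\<close>
    have "{S\<in>\<S>. i \<notin> S} = {S. S \<subseteq> {..<n} - {i} \<and> card S = k}" by (auto simp: \<S>_def)
    then have "card {S\<in>\<S>. i \<notin> S} = (n - 1) choose k" using i by (simp add: n_subsets)
    moreover have "card \<S> = card {S\<in>\<S>. i \<in> S} + card {S\<in>\<S>. i \<notin> S}"
      using fin by (subst card_Un_disjoint[symmetric]) (auto intro!: arg_cong[where f = card])
    moreover have "n choose k = ((n - 1) choose (k - 1)) + ((n - 1) choose k)"
      using k by (intro choose_reduce_nat) auto
    ultimately have "card {S\<in>\<S>. i \<in> S} = (n - 1) choose (k - 1)" using cardS by simp
    then have "n * card {S\<in>\<S>. i \<in> S} = k * card \<S>"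
      using times_binomial_minus1_eq[of k n] k cardS by simp
    then have "real n * real (card {S\<in>\<S>. i \<in> S}) = real k * real (card \<S>)"
      by (metis of_nat_mult)
    then show ?thesis using k by (simp add: field_simps)
  qed
  have "(\<Sum>S\<in>\<S>. \<Sum>i\<in>S. a i) = (\<Sum>S\<in>\<S>. \<Sum>i | i \<in> {..<n} \<and> i \<in> S. a i)"
    by (intro sum.cong) (auto simp: \<S>_def)
  also have "\<dots> = (\<Sum>i<n. \<Sum>S | S \<in> \<S> \<and> i \<in> S. a i)"
    by (rule sum.swap_restrict[OF fin]) simp
  also have "\<dots> = (\<Sum>i<n. real (card \<S>) * (real k / real n) * a i)"
    by (intro sum.cong) (auto simp: cnt)
  finally show ?thesis by (simp add: sum_distrib_left mult.assoc)
qed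

lemma norm_sum_sq_le:
  fixes a :: "'b \<Rightarrow> 'a::real_normed_vector"
  shows "(norm (\<Sum>i\<in>S. a i))\<^sup>2 \<le> real (card S) * (\<Sum>i\<in>S. (norm (a i))\<^sup>2)"
proof -
  have "(norm (\<Sum>i\<in>S. a i))\<^sup>2 \<le> (\<Sum>i\<in>S. norm (a i))\<^sup>2"
    by (intro power_mono norm_sum) auto
  also have "\<dots> \<le> real (card S) * (\<Sum>i\<in>S. (norm (a i))\<^sup>2)"
    using sum_squared_le_sum_of_squares[of "\<lambda>i. norm (a i)" S] by (simp add: mult.commute)
  finally show ?thesis .
qed

section \<open>Deterministic one-step estimates around a fixed KKT point
  \<open>(xs, us)\<close>\<close>

locale randprox_kkt =
  fixes f :: "'a::euclidean_space \<Rightarrow> real" and df :: "'a \<Rightarrow> 'a"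
    and g :: "'a \<Rightarrow> ereal" and h :: "nat \<Rightarrow> 'a \<Rightarrow> ereal"
    and n k :: nat and L mu_f mu_g mu_h \<gamma> :: real
    and xs :: 'a and us :: "nat \<Rightarrow> 'a"
  assumes k: "1 \<le> k" "k \<le> n"
    and f_grad: "\<And>x. (f has_derivative (\<lambda>d. df x \<bullet> d)) (at x)"
    and f_smooth: "\<And>x y. norm (df x - df y) \<le> L * norm (x - y)"
    and g_pcc: "proper_fun g" "closed_fun g" "convex_fun g"
    and h_proper: "\<And>i. i < n \<Longrightarrow> proper_fun (h i)"
    and mu_f: "mu_f \<ge> 0" "convex_on UNIV (\<lambda>x. f x - mu_f / 2 * (norm x)\<^sup>2)"
    and mu_g: "mu_g \<ge> 0" "strongly_convex_fun mu_g g"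
    and mu_h: "\<And>i. i < n \<Longrightarrow> strongly_convex_fun mu_h (conj_fun (h i))"
    and strong: "mu_f > 0 \<or> mu_g > 0" and mu_h_pos: "mu_h > 0"
    and gamma: "0 < \<gamma>" "\<gamma> * L < 2"
    and kkt_x: "- (df xs + (\<Sum>i<n. us i)) \<in> subdiff g xs"
    and kkt_u: "\<And>i. i < n \<Longrightarrow> xs \<in> subdiff (conj_fun (h i)) (us i)"
begin

definition dual_weight where
  "dual_weight = real n / real k * (\<gamma> * real n + 2 * mu_h)"

definition lyapunov where
  "lyapunov x u = 1 / \<gamma> * (norm (x - xs))\<^sup>2 + dual_weight * (\<Sum>i<n. (norm (u i - us i))\<^sup>2)"

definition rate where
  "rate = max (max ((1 - \<gamma> * mu_f)\<^sup>2 / (1 + \<gamma> * mu_g)) ((\<gamma> * L - 1)\<^sup>2 / (1 + \<gamma> * mu_g)))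
              (1 - 2 * real k * mu_h / (real n * (\<gamma> * real n + 2 * mu_h)))"

definition xhat where
  "xhat x u = prox \<gamma> g (x - \<gamma> *\<^sub>R df x - \<gamma> *\<^sub>R (\<Sum>i<n. u i))"

text \<open>The dual candidate exists for every index, sampled or not, so that for fixed
  \<open>x\<close> and \<open>u\<close> the step can be averaged over \<open>S\<close>.\<close>

definition uhat where
  "uhat x u i = prox (1 / (\<gamma> * real n)) (conj_fun (h i)) (u i + (1 / (\<gamma> * real n)) *\<^sub>R xhat x u)"

definition unext where
  "unext S x u = (\<lambda>i. if i \<in> S then uhat x u i else u i)"

definition xnext where
  "xnext S x u = xhat x u - (\<gamma> * real n / real k) *\<^sub>R ((\<Sum>i<n. unext S x u i) - (\<Sum>i<n. u i))"

lemma real_n_pos: "real n > 0" and real_k_pos: "real k > 0"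
  using k by auto

lemma dual_weight_pos: "dual_weight > 0"
  using real_n_pos real_k_pos gamma mu_h_pos by (auto simp: dual_weight_def intro!: divide_pos_pos mult_pos_pos add_pos_pos)

lemma lyapunov_nonneg: "lyapunov x u \<ge> 0"
  using dual_weight_pos gamma by (auto simp: lyapunov_def intro!: add_nonneg_nonneg mult_nonneg_nonneg sum_nonneg)

lemma rate_nonneg: "rate \<ge> 0"
proof -
  have "0 \<le> (\<gamma> * L - 1)\<^sup>2 / (1 + \<gamma> * mu_g)" using gamma mu_g by simp
  then show ?thesis unfolding rate_def by linarith
qed

lemma rate_less_1: "rate < 1"
proof -
  \<comment> \<open>A nonzero vector is what the comparison of \<open>mu_f\<close> with
    \<open>L\<close> needs; a basis element provides it.\<close>
  obtain b :: 'a where b: "b \<in> Basis" using nonempty_Basis by blast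
  then have "b \<noteq> 0" by auto
  then have le: "mu_f \<le> L"
    by (rule strong_convexity_le_smoothness[OF mu_f(2) f_grad f_smooth])
  \<comment> \<open>One estimate serves both quotients in \<open>rate\<close>, at
    \<open>m = mu_f\<close> and \<open>m = L\<close>. In the case \<open>m = 0\<close> also
    \<open>mu_f = 0\<close>, so strict decrease comes from \<open>mu_g\<close>.\<close>
  have sq: "(1 - \<gamma> * m)\<^sup>2 / (1 + \<gamma> * mu_g) < 1" if m: "mu_f \<le> m" "m \<le> L" for m
  proof -
    have "\<gamma> * m \<le> \<gamma> * L" using m gamma by simp
    then have lt: "\<gamma> * m < 2" using gamma by linarith
    have "(1 - \<gamma> * m)\<^sup>2 < 1 + \<gamma> * mu_g"
    proof (cases "m = 0")
      case True
      then show ?thesis using strong m mu_f mu_g gamma by auto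
    next
      case False
      then have "\<gamma> * m > 0" using m mu_f gamma by simp
      then have "\<gamma> * m * (2 - \<gamma> * m) > 0" using lt by simp
      then have "(1 - \<gamma> * m)\<^sup>2 < 1" by (simp add: power2_eq_square algebra_simps)
      then show ?thesis using mu_g gamma by (smt (verit) mult_nonneg_nonneg)
    qed
    then show ?thesis using mu_g gamma by (simp add: add_pos_nonneg)
  qed
  have "(\<gamma> * L - 1)\<^sup>2 = (1 - \<gamma> * L)\<^sup>2" by (rule power2_commute)
  moreover have "2 * real k * mu_h / (real n * (\<gamma> * real n + 2 * mu_h)) > 0"
    using real_n_pos real_k_pos gamma mu_h_pos by (auto intro!: divide_pos_pos mult_pos_pos add_pos_pos)
  ultimately show ?thesis unfolding rate_def using sq[of mu_f] sq[of L] le by auto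
qed

text \<open>The factor \<open>1 + \<gamma> * mu_g\<close> undoes the division inside
  \<open>rate\<close>; strong monotonicity of the subdifferential of \<open>g\<close> pays for it
  later.\<close>

lemma gradient_step:
  "(norm ((x - \<gamma> *\<^sub>R df x) - (xs - \<gamma> *\<^sub>R df xs)))\<^sup>2 \<le> (1 + \<gamma> * mu_g) * rate * (norm (x - xs))\<^sup>2"
proof -
  have pos: "1 + \<gamma> * mu_g > 0" using mu_g gamma by (simp add: add_pos_nonneg)
  have "(1 - \<gamma> * mu_f)\<^sup>2 / (1 + \<gamma> * mu_g) \<le> rate" "(\<gamma> * L - 1)\<^sup>2 / (1 + \<gamma> * mu_g) \<le> rate"
    by (auto simp: rate_def)
  then have "max ((1 - \<gamma> * mu_f)\<^sup>2) ((\<gamma> * L - 1)\<^sup>2) \<le> (1 + \<gamma> * mu_g) * rate"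
    using pos by (simp add: pos_divide_le_eq mult.commute)
  then show ?thesis
    using gradient_step_contraction[OF mu_f(2) f_grad f_smooth, of \<gamma> x xs] gamma
    by (meson less_imp_le mult_right_mono order_trans zero_le_power2)
qed

text \<open>Strong monotonicity is applied to the optimality condition at the proximal point and the
  KKT inclusion at \<open>xs\<close>; the part \<open>- (xhat x u - xs)\<close> of their difference
  moves to the left.\<close>

lemma xhat_bound:
  "(1 + \<gamma> * mu_g) * (norm (xhat x u - xs))\<^sup>2
     \<le> ((x - \<gamma> *\<^sub>R df x) - (xs - \<gamma> *\<^sub>R df xs) - \<gamma> *\<^sub>R ((\<Sum>i<n. u i) - (\<Sum>i<n. us i))) \<bullet> (xhat x u - xs)"
proof -
  define w where "w = x - \<gamma> *\<^sub>R df x - \<gamma> *\<^sub>R (\<Sum>i<n. u i)"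
  define w' where "w' = - (df xs + (\<Sum>i<n. us i))"
  have nm: "g x \<noteq> -\<infinity>" for x using g_pcc by (auto simp: proper_fun_def)
  have "(1 / \<gamma>) *\<^sub>R (w - xhat x u) \<in> subdiff g (xhat x u)"
    unfolding xhat_def w_def[symmetric] by (rule prox_subdiff[OF g_pcc(2,3) nm gamma(1) kkt_x])
  from subdiff_strongly_monotone[OF mu_g(2) nm this kkt_x, folded w'_def]
  have "\<gamma> * (mu_g * (norm (xhat x u - xs))\<^sup>2) \<le> \<gamma> * (((1 / \<gamma>) *\<^sub>R (w - xhat x u) - w') \<bullet> (xhat x u - xs))"
    using gamma by simp
  also have "\<dots> = (\<gamma> *\<^sub>R ((1 / \<gamma>) *\<^sub>R (w - xhat x u) - w')) \<bullet> (xhat x u - xs)" by simp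
  also have "\<gamma> *\<^sub>R ((1 / \<gamma>) *\<^sub>R (w - xhat x u) - w')
      = ((x - \<gamma> *\<^sub>R df x) - (xs - \<gamma> *\<^sub>R df xs) - \<gamma> *\<^sub>R ((\<Sum>i<n. u i) - (\<Sum>i<n. us i))) - (xhat x u - xs)"
    using gamma by (simp add: scaleR_diff_right w_def w'_def algebra_simps)
  finally show ?thesis
    by (simp add: inner_diff_left[of _ "xhat x u - xs" "xhat x u - xs"] power2_norm_eq_inner algebra_simps)
qed

text \<open>The dual counterpart, with the remaining inner product expanded into squared
  distances.\<close>

lemma uhat_bound:
  assumes i: "i < n"
  shows "(\<gamma> * real n + 2 * mu_h) * (norm (uhat x u i - us i))\<^sup>2
     \<le> \<gamma> * real n * (norm (u i - us i))\<^sup>2 - \<gamma> * real n * (norm (uhat x u i - u i))\<^sup>2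
        + 2 * ((xhat x u - xs) \<bullet> (uhat x u i - us i))"
proof -
  define \<eta> where "\<eta> = \<gamma> * real n"
  have \<eta>: "\<eta> > 0" using gamma real_n_pos by (simp add: \<eta>_def)
  note pr = h_proper[OF i]
  define w where "w = u i + (1 / \<eta>) *\<^sub>R xhat x u"
  define p where "p = uhat x u i"
  have "(1 / (1 / \<eta>)) *\<^sub>R (w - p) \<in> subdiff (conj_fun (h i)) p"
    unfolding p_def uhat_def w_def[symmetric] \<eta>_def[symmetric]
    by (rule prox_subdiff[OF closed_conj_fun[OF pr] convex_conj_fun[OF pr] conj_fun_not_MInf[OF pr] _ kkt_u[OF i]])
       (use \<eta> in simp)
  then have "\<eta> *\<^sub>R (w - p) \<in> subdiff (conj_fun (h i)) p" by simp
  from subdiff_strongly_monotone[OF mu_h[OF i] conj_fun_not_MInf[OF pr] this kkt_u[OF i]]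
  have "mu_h * (norm (p - us i))\<^sup>2 \<le> (\<eta> *\<^sub>R (w - p) - xs) \<bullet> (p - us i)" .
  also have "\<eta> *\<^sub>R (w - p) - xs = \<eta> *\<^sub>R (u i - p) + (xhat x u - xs)"
    using \<eta> by (simp add: w_def algebra_simps)
  also have "\<dots> \<bullet> (p - us i) = \<eta> * ((u i - p) \<bullet> (p - us i)) + (xhat x u - xs) \<bullet> (p - us i)"
    by (simp add: inner_add_left)
  finally have 1: "mu_h * (norm (p - us i))\<^sup>2 \<le> \<eta> * ((u i - p) \<bullet> (p - us i)) + (xhat x u - xs) \<bullet> (p - us i)" .
  have "(norm (u i - us i))\<^sup>2 = (norm (p - u i))\<^sup>2 + 2 * ((u i - p) \<bullet> (p - us i)) + (norm (p - us i))\<^sup>2"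
    using norm_add_sq[of "u i - p" "p - us i"] by (simp add: norm_minus_commute)
  then have "\<eta> * (norm (u i - us i))\<^sup>2
      = \<eta> * ((norm (p - u i))\<^sup>2 + 2 * ((u i - p) \<bullet> (p - us i)) + (norm (p - us i))\<^sup>2)" by simp
  with 1 show ?thesis unfolding p_def[symmetric] \<eta>_def[symmetric] by (simp add: algebra_simps)
qed

text \<open>Upper bound for the effect on the Lyapunov function of sampling \<open>i\<close>. It
  does not depend on \<open>S\<close>, which makes averaging possible.\<close>

definition update_cost where
  "update_cost x u i = - (2 * real n / real k) * ((xhat x u - xs) \<bullet> (uhat x u i - u i))
      + \<gamma> * (real n)\<^sup>2 / real k * (norm (uhat x u i - u i))\<^sup>2
      + dual_weight * ((norm (uhat x u i - us i))\<^sup>2 - (norm (u i - us i))\<^sup>2)"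

lemma lyapunov_step_le:
  assumes S: "S \<subseteq> {..<n}" "card S = k"
  shows "lyapunov (xnext S x u) (unext S x u)
    \<le> 1 / \<gamma> * (norm (xhat x u - xs))\<^sup>2 + dual_weight * (\<Sum>i<n. (norm (u i - us i))\<^sup>2) + (\<Sum>i\<in>S. update_cost x u i)"
proof -
  define \<delta> where "\<delta> = (\<lambda>i. uhat x u i - u i)"
  define D where "D = (\<Sum>i\<in>S. \<delta> i)"
  define \<beta> where "\<beta> = \<gamma> * real n / real k"
  have restrict: "(\<Sum>i<n. if i \<in> S then z i else 0) = (\<Sum>i\<in>S. z i)" for z :: "nat \<Rightarrow> 'c::comm_monoid_add"
    using S by (simp add: sum.If_cases Int_absorb1)
  have "(\<Sum>i<n. unext S x u i) - (\<Sum>i<n. u i) = (\<Sum>i<n. if i \<in> S then \<delta> i else 0)"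
    unfolding sum_subtractf[symmetric] by (intro sum.cong) (auto simp: unext_def \<delta>_def)
  then have xn: "xnext S x u - xs = (xhat x u - xs) - \<beta> *\<^sub>R D"
    by (simp add: xnext_def restrict D_def \<beta>_def)
  have "(\<Sum>i<n. (norm (unext S x u i - us i))\<^sup>2)
      = (\<Sum>i<n. (norm (u i - us i))\<^sup>2 + (if i \<in> S then (norm (uhat x u i - us i))\<^sup>2 - (norm (u i - us i))\<^sup>2 else 0))"
    by (intro sum.cong) (auto simp: unext_def)
  then have un: "(\<Sum>i<n. (norm (unext S x u i - us i))\<^sup>2)
      = (\<Sum>i<n. (norm (u i - us i))\<^sup>2) + (\<Sum>i\<in>S. (norm (uhat x u i - us i))\<^sup>2 - (norm (u i - us i))\<^sup>2)"
    by (simp add: sum.distrib restrict)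
  \<comment> \<open>The \<open>card S = k\<close> from Cauchy--Schwarz cancels one of the two
    factors \<open>k\<close> in the denominator of \<beta>^2.\<close>
  have "1 / \<gamma> * \<beta>\<^sup>2 * (norm D)\<^sup>2 \<le> 1 / \<gamma> * \<beta>\<^sup>2 * (real k * (\<Sum>i\<in>S. (norm (\<delta> i))\<^sup>2))"
    using norm_sum_sq_le[of \<delta> S] S gamma unfolding D_def by (intro mult_left_mono) auto
  also have "\<dots> = \<gamma> * (real n)\<^sup>2 / real k * (\<Sum>i\<in>S. (norm (\<delta> i))\<^sup>2)"
    using gamma real_k_pos by (simp add: \<beta>_def field_simps power2_eq_square)
  finally have D: "1 / \<gamma> * \<beta>\<^sup>2 * (norm D)\<^sup>2 \<le> \<gamma> * (real n)\<^sup>2 / real k * (\<Sum>i\<in>S. (norm (\<delta> i))\<^sup>2)" .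
  have "1 / \<gamma> * (norm (xnext S x u - xs))\<^sup>2
      = 1 / \<gamma> * (norm (xhat x u - xs))\<^sup>2 - 2 / \<gamma> * \<beta> * ((xhat x u - xs) \<bullet> D) + 1 / \<gamma> * \<beta>\<^sup>2 * (norm D)\<^sup>2"
    unfolding xn norm_diff_sq by (simp add: power_mult_distrib algebra_simps)
  also have "2 / \<gamma> * \<beta> * ((xhat x u - xs) \<bullet> D) = 2 * real n / real k * (\<Sum>i\<in>S. (xhat x u - xs) \<bullet> \<delta> i)"
    using gamma by (simp add: D_def \<beta>_def inner_sum_right)
  finally have x: "1 / \<gamma> * (norm (xnext S x u - xs))\<^sup>2
      \<le> 1 / \<gamma> * (norm (xhat x u - xs))\<^sup>2 - 2 * real n / real k * (\<Sum>i\<in>S. (xhat x u - xs) \<bullet> \<delta> i)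
         + \<gamma> * (real n)\<^sup>2 / real k * (\<Sum>i\<in>S. (norm (\<delta> i))\<^sup>2)"
    using D by linarith
  have "(\<Sum>i\<in>S. update_cost x u i) = - (2 * real n / real k) * (\<Sum>i\<in>S. (xhat x u - xs) \<bullet> \<delta> i)
      + \<gamma> * (real n)\<^sup>2 / real k * (\<Sum>i\<in>S. (norm (\<delta> i))\<^sup>2)
      + dual_weight * (\<Sum>i\<in>S. (norm (uhat x u i - us i))\<^sup>2 - (norm (u i - us i))\<^sup>2)"
    unfolding update_cost_def \<delta>_def sum.distrib sum_distrib_left ..
  then show ?thesis using x unfolding lyapunov_def un by (simp add: algebra_simps)
qed

text \<open>Both the variance terms \<open>\<parallel>uhat - u\<parallel>\<^sup>2\<close> and the couplings
  \<open>(xhat - xs) \<bullet> uhat\<close> cancel exactly once the sampled sum is averaged.\<close>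

lemma averaged_bound:
  shows "1 / \<gamma> * (norm (xhat x u - xs))\<^sup>2 + dual_weight * (\<Sum>i<n. (norm (u i - us i))\<^sup>2)
      + real k / real n * (\<Sum>i<n. update_cost x u i) \<le> rate * lyapunov x u"
proof -
  define X where "X = xhat x u - xs"
  define W where "W = (x - \<gamma> *\<^sub>R df x) - (xs - \<gamma> *\<^sub>R df xs)"
  define V where "V = (\<Sum>i<n. u i) - (\<Sum>i<n. us i)"
  define N where "N = (\<Sum>i<n. (norm (u i - us i))\<^sup>2)"
  define \<mu> where "\<mu> = \<gamma> * real n + 2 * mu_h"
  \<comment> \<open>Averaging turns the dual weight into exactly the coefficient on the left of
    \<open>uhat_bound\<close>.\<close>
  have kw: "real k / real n * dual_weight = \<mu>"
    using real_n_pos real_k_pos by (simp add: dual_weight_def \<mu>_def)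
  have cost: "real k / real n * update_cost x u i \<le> 2 * (X \<bullet> (u i - us i)) - 2 * mu_h * (norm (u i - us i))\<^sup>2" if i: "i < n" for i
  proof -
    have "real k / real n * update_cost x u i = - 2 * (X \<bullet> (uhat x u i - u i)) + \<gamma> * real n * (norm (uhat x u i - u i))\<^sup>2
       + \<mu> * ((norm (uhat x u i - us i))\<^sup>2 - (norm (u i - us i))\<^sup>2)"
      unfolding update_cost_def X_def[symmetric] distrib_left kw[symmetric]
      using real_n_pos real_k_pos by (simp add: power2_eq_square)
    also have "\<dots> \<le> 2 * (X \<bullet> (uhat x u i - us i)) - 2 * (X \<bullet> (uhat x u i - u i)) - 2 * mu_h * (norm (u i - us i))\<^sup>2"
      using uhat_bound[OF i, of x u] unfolding X_def[symmetric] by (simp add: \<mu>_def algebra_simps)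
    also have "\<dots> = 2 * (X \<bullet> (u i - us i)) - 2 * mu_h * (norm (u i - us i))\<^sup>2"
      by (simp add: inner_diff_right)
    finally show ?thesis .
  qed
  have "real k / real n * (\<Sum>i<n. update_cost x u i) \<le> (\<Sum>i<n. 2 * (X \<bullet> (u i - us i)) - 2 * mu_h * (norm (u i - us i))\<^sup>2)"
    unfolding sum_distrib_left by (intro sum_mono cost) auto
  also have "\<dots> = 2 * (X \<bullet> V) - 2 * mu_h * N"
    unfolding V_def N_def sum_subtractf[symmetric] inner_sum_right sum_distrib_left by simp
  finally have 1: "real k / real n * (\<Sum>i<n. update_cost x u i) \<le> 2 * (X \<bullet> V) - 2 * mu_h * N" .
  have "\<mu> > 0" using gamma real_n_pos mu_h_pos by (auto simp: \<mu>_def intro!: add_pos_pos)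
  \<comment> \<open>The third entry of \<open>rate\<close> is the relative loss of dual weight
    caused by the term - 2 \<open>mu_h\<close> N.\<close>
  then have "dual_weight - 2 * mu_h = dual_weight * (1 - 2 * real k * mu_h / (real n * \<mu>))"
    unfolding dual_weight_def \<mu>_def[symmetric] using real_n_pos real_k_pos by (simp add: field_simps)
  also have "\<dots> \<le> dual_weight * rate"
    using dual_weight_pos by (intro mult_left_mono) (auto simp: rate_def \<mu>_def)
  finally have "(dual_weight - 2 * mu_h) * N \<le> dual_weight * rate * N"
    by (intro mult_right_mono) (auto simp: N_def sum_nonneg)
  moreover have "1 / \<gamma> * (norm X)\<^sup>2 + 2 * (X \<bullet> V) \<le> rate * (1 / \<gamma> * (norm (x - xs))\<^sup>2)"
  proof -
    define m where "m = 1 + \<gamma> * mu_g"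
    have m: "m \<ge> 1" using mu_g gamma by (simp add: m_def)
    have "m * (norm X)\<^sup>2 \<le> (W - \<gamma> *\<^sub>R V) \<bullet> X"
      using xhat_bound[of x u] by (simp add: X_def W_def V_def m_def)
    then have 2: "m * (norm X)\<^sup>2 \<le> W \<bullet> X - \<gamma> * (X \<bullet> V)" by (simp add: inner_diff_left inner_commute[of X V])
    \<comment> \<open>Young's inequality weighted by \<open>m\<close>: after division by
      \<open>m\<close>, the gradient step contributes only \<open>rate\<close>.\<close>
    have "0 \<le> (norm W)\<^sup>2 - 2 * (W \<bullet> (m *\<^sub>R X)) + (norm (m *\<^sub>R X))\<^sup>2"
      unfolding norm_diff_sq[symmetric] by simp
    then have "2 * (W \<bullet> X) * m \<le> (norm W)\<^sup>2 + m * (m * (norm X)\<^sup>2)"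
      by (simp add: power_mult_distrib power2_eq_square algebra_simps)
    moreover have "(norm W)\<^sup>2 \<le> m * rate * (norm (x - xs))\<^sup>2"
      using gradient_step[of x] by (simp add: W_def m_def)
    ultimately have "m * (2 * (W \<bullet> X)) \<le> m * (rate * (norm (x - xs))\<^sup>2 + m * (norm X)\<^sup>2)"
      by (simp add: algebra_simps)
    then have "2 * (W \<bullet> X) \<le> rate * (norm (x - xs))\<^sup>2 + m * (norm X)\<^sup>2" using m by simp
    moreover have "1 * (norm X)\<^sup>2 \<le> m * (norm X)\<^sup>2" using m by (intro mult_right_mono) auto
    ultimately have "(norm X)\<^sup>2 + 2 * \<gamma> * (X \<bullet> V) \<le> rate * (norm (x - xs))\<^sup>2" using 2 by (simp add: algebra_simps)
    then have "((norm X)\<^sup>2 + 2 * \<gamma> * (X \<bullet> V)) / \<gamma> \<le> rate * (norm (x - xs))\<^sup>2 / \<gamma>"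
      using gamma by (simp add: divide_right_mono)
    then show ?thesis using gamma by (simp add: add_divide_distrib)
  qed
  ultimately show ?thesis using 1
    unfolding lyapunov_def X_def[symmetric] N_def[symmetric] by (simp add: algebra_simps)
qed

section \<open>Averaging one step over the sampled sets\<close>

definition samples where "samples = {S. S \<subseteq> {..<n} \<and> card S = k}"

lemma finite_samples: "finite samples"
  unfolding samples_def by (rule finite_subset[of _ "Pow {..<n}"]) auto

lemma samples_nonempty: "samples \<noteq> {}"
proof -
  have "{..<k} \<in> samples" using k by (auto simp: samples_def)
  then show ?thesis by blast
qed

lemma sum_lyapunov_step_le:
  "(\<Sum>S\<in>samples. lyapunov (xnext S x u) (unext S x u)) \<le> real (card samples) * (rate * lyapunov x u)"
proof -
  define C where "C = 1 / \<gamma> * (norm (xhat x u - xs))\<^sup>2 + dual_weight * (\<Sum>i<n. (norm (u i - us i))\<^sup>2)"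
  have "(\<Sum>S\<in>samples. lyapunov (xnext S x u) (unext S x u)) \<le> (\<Sum>S\<in>samples. C + (\<Sum>i\<in>S. update_cost x u i))"
    unfolding C_def by (intro sum_mono lyapunov_step_le) (auto simp: samples_def)
  also have "\<dots> = real (card samples) * (C + real k / real n * (\<Sum>i<n. update_cost x u i))"
    using sum_over_k_subsets[OF k, of "update_cost x u"] by (simp add: sum.distrib samples_def algebra_simps)
  also have "\<dots> \<le> real (card samples) * (rate * lyapunov x u)"
    unfolding C_def by (intro mult_left_mono averaged_bound) auto
  finally show ?thesis .
qed

end

section \<open>Expectation and almost sure convergence\<close>

text \<open>\<open>F\<close> factors through the list of the first \<open>t\<close> samples cut down
  to \<open>A\<close>. Only finitely many such lists exist, so every function of the list is
  measurable, whatever choices \<open>prox\<close> makes.\<close>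

lemma measurable_stream_finite_dependence:
  fixes F :: "'b set stream \<Rightarrow> 'c"
  assumes A: "finite A" and N: "space N = UNIV"
    and F: "\<And>\<omega> \<omega>'. (\<And>s. s < t \<Longrightarrow> \<omega> !! s \<inter> A = \<omega>' !! s \<inter> A) \<Longrightarrow> F \<omega> = F \<omega>'"
  shows "F \<in> measurable (stream_space (measure_pmf p)) N"
proof -
  let ?M = "stream_space (measure_pmf p)"
  define R where "R \<omega> = map (\<lambda>S. S \<inter> A) (stake t \<omega>)" for \<omega> :: "'b set stream"
  define I where "I = {l. set l \<subseteq> Pow A \<and> length l = t}"
  have R: "R \<in> measurable ?M (count_space I)"
  proof (subst measurable_count_space_eq2, unfold I_def)
    show "finite {l. set l \<subseteq> Pow A \<and> length l = t}" using A by (intro finite_lists_length_eq) auto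
    show "R \<in> space ?M \<rightarrow> {l. set l \<subseteq> Pow A \<and> length l = t} \<and>
        (\<forall>l\<in>{l. set l \<subseteq> Pow A \<and> length l = t}. R -` {l} \<inter> space ?M \<in> sets ?M)"
    proof (intro conjI ballI)
      fix l assume l: "l \<in> {l. set l \<subseteq> Pow A \<and> length l = t}"
      have "R \<omega> = l \<longleftrightarrow> (\<forall>s\<in>{..<t}. \<omega> !! s \<inter> A = l ! s)" for \<omega>
        using l by (subst list_eq_iff_nth_eq) (simp add: R_def Ball_def)
      then have "R -` {l} \<inter> space ?M = {\<omega>\<in>space ?M. \<forall>s\<in>{..<t}. \<omega> !! s \<inter> A = l ! s}" by blast
      also have "\<dots> \<in> sets ?M"
      proof (rule sets.sets_Collect_finite_All)
        fix s
        have "(\<lambda>\<omega>. \<omega> !! s) -` {S. S \<inter> A = l ! s} \<inter> space ?M \<in> sets ?M"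
          by (rule measurable_sets[OF measurable_snth]) simp
        moreover have "(\<lambda>\<omega>. \<omega> !! s) -` {S. S \<inter> A = l ! s} \<inter> space ?M = {\<omega> \<in> space ?M. \<omega> !! s \<inter> A = l ! s}"
          by blast
        ultimately show "{\<omega> \<in> space ?M. \<omega> !! s \<inter> A = l ! s} \<in> sets ?M" by (rule back_subst)
      qed simp
      finally show "R -` {l} \<inter> space ?M \<in> sets ?M" .
    qed (auto simp: R_def)
  qed
  \<comment> \<open>Padding with empty sets turns the list back into a stream on which
    \<open>F\<close> has the same value.\<close>
  have "F = (\<lambda>\<omega>. F (R \<omega> @- sconst {}))"
    by (rule ext, rule F) (simp add: R_def)
  moreover have "(\<lambda>\<omega>. F (R \<omega> @- sconst {})) \<in> measurable ?M N"
    by (rule measurable_compose[OF R]) (simp add: N)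
  ultimately show ?thesis by simp
qed

section \<open>The iterates as functions of the sample stream\<close>

context randprox_kkt
begin

abbreviation state where "state \<equiv> randprox_state df g h n k \<gamma>"

lemma state_Suc:
  "state x u Om (Suc t) = (xnext (Om t) (fst (state x u Om t)) (snd (state x u Om t)),
                           unext (Om t) (fst (state x u Om t)) (snd (state x u Om t)))"
  unfolding randprox_state.simps Let_def case_prod_beta xnext_def unext_def uhat_def xhat_def by simp

declare randprox_state.simps(2) [simp del]

text \<open>Unrolling the first step instead of the last matches the integral over streams, which
  splits off the first sample.\<close>

lemma state_shift:
  "state x u Om (Suc t) = state (xnext (Om 0) x u) (unext (Om 0) x u) (\<lambda>s. Om (Suc s)) t"
proof (induction t)
  case (Suc t)
  show ?case by (subst (1 2) state_Suc) (simp only: Suc)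
qed (simp add: state_Suc)

lemma xhat_cong: "(\<And>i. i < n \<Longrightarrow> u i = u' i) \<Longrightarrow> xhat x u = xhat x u'"
  unfolding xhat_def by (metis (no_types, lifting) lessThan_iff sum.cong)

lemma unext_cong:
  assumes "S \<inter> {..<n} = S' \<inter> {..<n}" "\<And>i. i < n \<Longrightarrow> u i = u' i" "i < n"
  shows "unext S x u i = unext S' x u' i"
proof -
  have "xhat x u = xhat x u'" by (rule xhat_cong) (rule assms)
  then show ?thesis using assms by (auto simp: unext_def uhat_def)
qed

lemma xnext_cong:
  assumes "S \<inter> {..<n} = S' \<inter> {..<n}" "\<And>i. i < n \<Longrightarrow> u i = u' i"
  shows "xnext S x u = xnext S' x u'"
proof -
  have "xhat x u = xhat x u'" by (rule xhat_cong) (rule assms)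
  moreover have "(\<Sum>i<n. unext S x u i) = (\<Sum>i<n. unext S' x u' i)"
    using assms by (intro sum.cong unext_cong) auto
  moreover have "(\<Sum>i<n. u i) = (\<Sum>i<n. u' i)" using assms by (intro sum.cong) auto
  ultimately show ?thesis by (simp add: xnext_def)
qed

text \<open>Sets agreeing on \<open>{..<n}\<close> may still differ in updating coordinates beyond
  \<open>n\<close>; hence the dual agreement is restricted to \<open>i < n\<close>, all that the
  sums use.\<close>

lemma state_cong:
  assumes "\<And>s. s < t \<Longrightarrow> Om s \<inter> {..<n} = Om' s \<inter> {..<n}"
  shows "fst (state x u Om t) = fst (state x u Om' t) \<and> (\<forall>i<n. snd (state x u Om t) i = snd (state x u Om' t) i)"
  using assms
proof (induction t)
  case (Suc t)
  then have IH: "fst (state x u Om t) = fst (state x u Om' t)"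
    "\<And>i. i < n \<Longrightarrow> snd (state x u Om t) i = snd (state x u Om' t) i" by simp_all
  have Om: "Om t \<inter> {..<n} = Om' t \<inter> {..<n}" by (rule Suc.prems) simp
  show ?case unfolding state_Suc IH(1) fst_conv snd_conv
    by (intro conjI allI impI xnext_cong[OF Om] unext_cong[OF Om]) (auto intro: IH(2))
qed simp

definition lyapunov_at where
  "lyapunov_at x u t \<omega> = lyapunov (fst (state x u (snth \<omega>) t)) (snd (state x u (snth \<omega>) t))"

lemma measurable_lyapunov_at [measurable]:
  "(\<lambda>\<omega>. ennreal (lyapunov_at x u t \<omega>)) \<in> borel_measurable (sampling_space n k)"
  unfolding sampling_space_def
proof (rule measurable_stream_finite_dependence[of "{..<n}" _ t])
  fix \<omega> \<omega>' :: "nat set stream"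
  assume "\<And>s. s < t \<Longrightarrow> \<omega> !! s \<inter> {..<n} = \<omega>' !! s \<inter> {..<n}"
  note eq = state_cong[of t "snth \<omega>" "snth \<omega>'" x u, OF this]
  have "(\<Sum>i<n. (norm (snd (state x u (snth \<omega>) t) i - us i))\<^sup>2) = (\<Sum>i<n. (norm (snd (state x u (snth \<omega>') t) i - us i))\<^sup>2)"
    using eq by (intro sum.cong) auto
  then show "ennreal (lyapunov_at x u t \<omega>) = ennreal (lyapunov_at x u t \<omega>')"
    using eq by (simp add: lyapunov_at_def lyapunov_def)
qed auto

lemma prob_space_sampling: "prob_space (sampling_space n k)"
  unfolding sampling_space_def by (rule prob_space.prob_space_stream_space[OF prob_space_measure_pmf])

text \<open>Induction with arbitrary initial state: the first sample is integrated last, and the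
  hypothesis applies to the state it produces. Iterated integrals thus take the role of conditional
  expectations.\<close>

lemma expected_lyapunov_le:
  "(\<integral>\<^sup>+\<omega>. ennreal (lyapunov_at x u t \<omega>) \<partial>sampling_space n k) \<le> ennreal (rate ^ t * lyapunov x u)"
proof (induction t arbitrary: x u)
  case 0
  interpret prob_space "sampling_space n k" by (rule prob_space_sampling)
  show ?case by (simp add: lyapunov_at_def emeasure_space_1)
next
  case (Suc t)
  let ?P = "measure_pmf (pmf_of_set samples)"
  have M: "sampling_space n k = stream_space ?P" by (simp add: sampling_space_def samples_def)
  have card: "card samples > 0" using finite_samples samples_nonempty by (simp add: card_gt_0_iff)
  have shift: "lyapunov_at x u (Suc t) (S ## \<omega>) = lyapunov_at (xnext S x u) (unext S x u) t \<omega>" for S \<omega>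
    unfolding lyapunov_at_def state_shift by (simp add: snth.simps(2)[abs_def])
  have "(\<integral>\<^sup>+\<omega>. ennreal (lyapunov_at x u (Suc t) \<omega>) \<partial>sampling_space n k)
      = (\<integral>\<^sup>+S. (\<integral>\<^sup>+\<omega>. ennreal (lyapunov_at x u (Suc t) (S ## \<omega>)) \<partial>stream_space ?P) \<partial>?P)"
    unfolding M by (rule prob_space.nn_integral_stream_space[OF prob_space_measure_pmf]) (rule measurable_lyapunov_at[unfolded M])
  also have "\<dots> \<le> (\<integral>\<^sup>+S. ennreal (rate ^ t * lyapunov (xnext S x u) (unext S x u)) \<partial>?P)"
    unfolding shift by (intro nn_integral_mono) (rule Suc[unfolded M])
  also have "\<dots> = (\<Sum>S\<in>samples. ennreal (rate ^ t * lyapunov (xnext S x u) (unext S x u))) / of_nat (card samples)"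
    using finite_samples samples_nonempty by (simp add: nn_integral_pmf_of_set ennreal_of_nat_eq_real_of_nat)
  also have "\<dots> = ennreal ((\<Sum>S\<in>samples. rate ^ t * lyapunov (xnext S x u) (unext S x u)) / real (card samples))"
    using card by (simp add: sum_ennreal rate_nonneg lyapunov_nonneg sum_nonneg
        ennreal_of_nat_eq_real_of_nat divide_ennreal)
  also have "\<dots> \<le> ennreal (rate ^ Suc t * lyapunov x u)"
  proof (rule ennreal_leI)
    have "rate ^ t * (\<Sum>S\<in>samples. lyapunov (xnext S x u) (unext S x u))
        \<le> rate ^ t * (real (card samples) * (rate * lyapunov x u))"
      by (intro mult_left_mono sum_lyapunov_step_le) (simp add: rate_nonneg)
    then show "(\<Sum>S\<in>samples. rate ^ t * lyapunov (xnext S x u) (unext S x u)) / real (card samples)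
        \<le> rate ^ Suc t * lyapunov x u"
      using card by (simp add: sum_distrib_left[symmetric] pos_divide_le_eq mult_ac)
  qed
  finally show ?case .
qed

text \<open>The expectations are dominated by a convergent geometric series, so the sum over time
  has finite expectation and is almost surely finite; its terms must vanish.\<close>

lemma AE_lyapunov_tendsto_0:
  "AE \<omega> in sampling_space n k. (\<lambda>t. lyapunov_at x u t \<omega>) \<longlonglongrightarrow> 0"
proof -
  let ?M = "sampling_space n k"
  have "summable (\<lambda>t. rate ^ t * lyapunov x u)"
    using rate_nonneg rate_less_1 by (intro summable_mult2 summable_geometric) simp
  then have "(\<Sum>t. ennreal (rate ^ t * lyapunov x u)) \<noteq> top"
    by (rule ennreal_suminf_neq_top) (simp add: rate_nonneg lyapunov_nonneg)
  moreover have "(\<integral>\<^sup>+\<omega>. (\<Sum>t. ennreal (lyapunov_at x u t \<omega>)) \<partial>?M) \<le> (\<Sum>t. ennreal (rate ^ t * lyapunov x u))"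
    by (subst nn_integral_suminf) (auto intro!: suminf_le expected_lyapunov_le)
  ultimately have "(\<integral>\<^sup>+\<omega>. (\<Sum>t. ennreal (lyapunov_at x u t \<omega>)) \<partial>?M) \<noteq> \<infinity>"
    by (auto simp: top_unique)
  then have "AE \<omega> in ?M. (\<Sum>t. ennreal (lyapunov_at x u t \<omega>)) \<noteq> \<infinity>"
    by (intro nn_integral_PInf_AE) auto
  then show ?thesis
  proof eventually_elim
    case (elim \<omega>)
    then have "summable (\<lambda>t. lyapunov_at x u t \<omega>)"
      by (intro summable_suminf_not_top) (auto simp: lyapunov_at_def lyapunov_nonneg)
    then show ?case by (rule summable_LIMSEQ_zero)
  qed
qed

section \<open>From vanishing Lyapunov values to convergence of the iterates\<close>

lemma lyapunov_dominates_x: "norm (x - xs) \<le> sqrt (\<gamma> * lyapunov x u)"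
proof (rule real_le_rsqrt)
  have "0 \<le> dual_weight * (\<Sum>i<n. (norm (u i - us i))\<^sup>2)"
    using dual_weight_pos by (intro mult_nonneg_nonneg sum_nonneg) auto
  then have "1 / \<gamma> * (norm (x - xs))\<^sup>2 \<le> lyapunov x u" by (simp add: lyapunov_def)
  then show "(norm (x - xs))\<^sup>2 \<le> \<gamma> * lyapunov x u" using gamma by (simp add: field_simps)
qed

lemma lyapunov_dominates_u:
  assumes i: "i < n"
  shows "norm (u i - us i) \<le> sqrt (lyapunov x u / dual_weight)"
proof (rule real_le_rsqrt)
  have "(norm (u i - us i))\<^sup>2 \<le> (\<Sum>i<n. (norm (u i - us i))\<^sup>2)"
    using i by (intro member_le_sum) auto
  then have "dual_weight * (norm (u i - us i))\<^sup>2 \<le> dual_weight * (\<Sum>i<n. (norm (u i - us i))\<^sup>2)"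
    using dual_weight_pos by (intro mult_left_mono) auto
  also have "\<dots> \<le> lyapunov x u" using gamma by (simp add: lyapunov_def)
  finally show "(norm (u i - us i))\<^sup>2 \<le> lyapunov x u / dual_weight"
    using dual_weight_pos by (simp add: field_simps)
qed

text \<open>\<open>xhat\<close> does not occur in the Lyapunov function. Cauchy--Schwarz in
  \<open>xhat_bound\<close> bounds its error by a quantity that vanishes as \<open>x\<close> and
  \<open>u\<close> converge.\<close>

lemma norm_xhat_le:
  "norm (xhat x u - xs) \<le> norm ((x - \<gamma> *\<^sub>R df x) - (xs - \<gamma> *\<^sub>R df xs)
      - \<gamma> *\<^sub>R ((\<Sum>i<n. u i) - (\<Sum>i<n. us i)))" (is "_ \<le> norm ?w")
proof (cases "xhat x u = xs")
  case False
  have "1 * (norm (xhat x u - xs))\<^sup>2 \<le> (1 + \<gamma> * mu_g) * (norm (xhat x u - xs))\<^sup>2"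
    using mu_g gamma by (intro mult_right_mono) auto
  also have "\<dots> \<le> ?w \<bullet> (xhat x u - xs)" by (rule xhat_bound)
  also have "\<dots> \<le> norm ?w * norm (xhat x u - xs)" by (rule norm_cauchy_schwarz)
  finally show ?thesis using False by (simp add: power2_eq_square)
qed simp

lemma convergence_if_lyapunov_tendsto_0:
  assumes lim: "(\<lambda>t. lyapunov (x t) (u t)) \<longlonglongrightarrow> 0"
  shows "x \<longlonglongrightarrow> xs" and "i < n \<Longrightarrow> (\<lambda>t. u t i) \<longlonglongrightarrow> us i"
    and "(\<lambda>t. xhat (x t) (u t)) \<longlonglongrightarrow> xs"
proof -
  have "(\<lambda>t. sqrt (\<gamma> * lyapunov (x t) (u t))) \<longlonglongrightarrow> sqrt (\<gamma> * 0)"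
    by (intro tendsto_intros lim)
  then have "(\<lambda>t. sqrt (\<gamma> * lyapunov (x t) (u t))) \<longlonglongrightarrow> 0" by simp
  then have "(\<lambda>t. x t - xs) \<longlonglongrightarrow> 0"
    by (rule Lim_null_comparison[rotated]) (intro always_eventually allI lyapunov_dominates_x)
  then show x: "x \<longlonglongrightarrow> xs" by (rule LIM_zero_cancel)
  have u: "(\<lambda>t. u t i) \<longlonglongrightarrow> us i" if i: "i < n" for i
  proof -
    have "(\<lambda>t. sqrt (lyapunov (x t) (u t) / dual_weight)) \<longlonglongrightarrow> sqrt (0 / dual_weight)"
      using dual_weight_pos by (intro tendsto_intros lim) auto
    then have "(\<lambda>t. sqrt (lyapunov (x t) (u t) / dual_weight)) \<longlonglongrightarrow> 0" by simp
    then have "(\<lambda>t. u t i - us i) \<longlonglongrightarrow> 0"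
      by (rule Lim_null_comparison[rotated]) (intro always_eventually allI lyapunov_dominates_u[OF i])
    then show ?thesis by (rule LIM_zero_cancel)
  qed
  then show "i < n \<Longrightarrow> (\<lambda>t. u t i) \<longlonglongrightarrow> us i" .
  have "(\<lambda>t. L * norm (x t - xs)) \<longlonglongrightarrow> L * norm (xs - xs)" by (intro tendsto_intros x)
  then have "(\<lambda>t. L * norm (x t - xs)) \<longlonglongrightarrow> 0" by simp
  then have "(\<lambda>t. df (x t) - df xs) \<longlonglongrightarrow> 0"
    by (rule Lim_null_comparison[rotated]) (intro always_eventually allI f_smooth)
  then have df: "(\<lambda>t. df (x t)) \<longlonglongrightarrow> df xs" by (rule LIM_zero_cancel)
  define w where "w t = norm ((x t - \<gamma> *\<^sub>R df (x t)) - (xs - \<gamma> *\<^sub>R df xs) - \<gamma> *\<^sub>R ((\<Sum>i<n. u t i) - (\<Sum>i<n. us i)))" for t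
  have "w \<longlonglongrightarrow> norm ((xs - \<gamma> *\<^sub>R df xs) - (xs - \<gamma> *\<^sub>R df xs) - \<gamma> *\<^sub>R ((\<Sum>i<n. us i) - (\<Sum>i<n. us i)))"
    unfolding w_def by (intro tendsto_intros x df u) auto
  then have "w \<longlonglongrightarrow> 0" by simp
  then have "(\<lambda>t. xhat (x t) (u t) - xs) \<longlonglongrightarrow> 0"
    unfolding w_def by (rule Lim_null_comparison[rotated]) (intro always_eventually allI norm_xhat_le)
  then show "(\<lambda>t. xhat (x t) (u t)) \<longlonglongrightarrow> xs" by (rule LIM_zero_cancel)
qed

end

section \<open>Uniqueness of the primal and dual solutions\<close>

context
  fixes f :: "'a::euclidean_space \<Rightarrow> real" and df :: "'a \<Rightarrow> 'a"
    and g :: "'a \<Rightarrow> ereal" and h :: "nat \<Rightarrow> 'a \<Rightarrow> ereal"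
    and n :: nat and mu_f mu_g mu_h :: real
    and xk :: 'a and uk :: "nat \<Rightarrow> 'a"
  assumes f_grad: "\<And>x. (f has_derivative (\<lambda>d. df x \<bullet> d)) (at x)"
    and g_proper: "proper_fun g"
    and h_pcc: "\<And>i. i < n \<Longrightarrow> proper_fun (h i) \<and> closed_fun (h i) \<and> convex_fun (h i)"
    and mu_f: "convex_on UNIV (\<lambda>x. f x - mu_f / 2 * (norm x)\<^sup>2)"
    and mu_g: "strongly_convex_fun mu_g g"
    and mu_h: "\<And>i. i < n \<Longrightarrow> strongly_convex_fun mu_h (conj_fun (h i))"
    and kkt_x: "- (df xk + (\<Sum>i<n. uk i)) \<in> subdiff g xk"
    and kkt_u: "\<And>i. i < n \<Longrightarrow> xk \<in> subdiff (conj_fun (h i)) (uk i)"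
begin

text \<open>In the sum of the strong convexity bounds for \<open>f\<close> and \<open>g\<close> the
  gradient cancels against the KKT subgradient, leaving only the slope from the dual
  variables.\<close>

lemma kkt_lower_bound:
  assumes gk: "g xk = ereal gk"
  shows "ereal (f xk + gk - (\<Sum>i<n. uk i) \<bullet> (x - xk) + (mu_f + mu_g) / 2 * (norm (x - xk))\<^sup>2) \<le> ereal (f x) + g x"
proof -
  have nm: "g x \<noteq> -\<infinity>" for x using g_proper by (auto simp: proper_fun_def)
  have "f xk + df xk \<bullet> (x - xk) + mu_f / 2 * (norm (x - xk))\<^sup>2 \<le> f x"
    by (rule gradient_above_tangent[OF mu_f f_grad])
  moreover have "ereal (gk + (- (df xk + (\<Sum>i<n. uk i)) \<bullet> (x - xk) + mu_g / 2 * (norm (x - xk))\<^sup>2)) \<le> g x"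
    using subdiff_strongly_convex[OF mu_g nm kkt_x, of x] by (simp add: gk)
  ultimately have "ereal (f xk + df xk \<bullet> (x - xk) + mu_f / 2 * (norm (x - xk))\<^sup>2)
     + ereal (gk + (- (df xk + (\<Sum>i<n. uk i)) \<bullet> (x - xk) + mu_g / 2 * (norm (x - xk))\<^sup>2)) \<le> ereal (f x) + g x"
    by (intro add_mono) simp_all
  then show ?thesis by (simp add: inner_add_left algebra_simps add_divide_distrib)
qed

text \<open>The affine minorants of the \<open>h i\<close> with slopes \<open>uk i\<close> cancel
  the linear term of \<open>kkt_lower_bound\<close>. Minimality against \<open>xk\<close> then
  forces the quadratic remainder to be nonpositive.\<close>

lemma primal_solution_unique:
  assumes strong: "mu_f + mu_g > 0"
    and sol: "\<And>x. ereal (f xs) + g xs + (\<Sum>i<n. h i xs) \<le> ereal (f x) + g x + (\<Sum>i<n. h i x)"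
  shows "xs = xk"
proof -
  obtain gk where gk: "g xk = ereal gk"
    using kkt_x g_proper by (cases "g xk") (auto simp: subdiff_def proper_fun_def)
  have "\<exists>a. h i xk = ereal a" if "i < n" for i
    using subdiff_conj_fun_eq[of "h i" xk "uk i"] h_pcc[OF that] kkt_u[OF that] by blast
  then obtain a where a: "\<And>i. i < n \<Longrightarrow> h i xk = ereal (a i)" by metis
  have "ereal (\<Sum>i<n. a i + uk i \<bullet> (xs - xk)) \<le> (\<Sum>i<n. h i xs)"
    unfolding sum_ereal[symmetric]
  proof (rule sum_mono)
    fix i assume "i \<in> {..<n}"
    then have i: "i < n" by simp
    have "uk i \<in> subdiff (h i) xk" using subdiff_conj_funD[OF _ _ _ kkt_u[OF i]] h_pcc[OF i] by blast
    then show "ereal (a i + uk i \<bullet> (xs - xk)) \<le> h i xs" by (auto simp: subdiff_def a[OF i])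
  qed
  with kkt_lower_bound[OF gk, of xs]
  have "ereal (f xk + gk - (\<Sum>i<n. uk i) \<bullet> (xs - xk) + (mu_f + mu_g) / 2 * (norm (xs - xk))\<^sup>2)
      + ereal (\<Sum>i<n. a i + uk i \<bullet> (xs - xk)) \<le> ereal (f xs) + g xs + (\<Sum>i<n. h i xs)"
    by (rule add_mono)
  also have "\<dots> \<le> ereal (f xk) + g xk + (\<Sum>i<n. h i xk)" by (rule sol)
  also have "(\<Sum>i<n. h i xk) = ereal (\<Sum>i<n. a i)" unfolding sum_ereal[symmetric] by (intro sum.cong) (auto simp: a)
  finally have "(mu_f + mu_g) / 2 * (norm (xs - xk))\<^sup>2 \<le> 0"
    by (simp add: gk sum.distrib inner_sum_left)
  then show ?thesis using strong by (simp add: mult_le_0_iff)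
qed

text \<open>The quadratic growth now comes from the conjugates \<open>conj_fun (h i)\<close>. The
  conjugate of f + g is bounded below at the solution by testing with \<open>xk\<close>, and above
  at the KKT point by \<open>kkt_lower_bound\<close>; the linear terms cancel.\<close>

lemma dual_solution_unique:
  assumes strong: "mu_f + mu_g \<ge> 0" "mu_h > 0"
    and sol: "\<And>u. conj_fun (\<lambda>x. ereal (f x) + g x) (- (\<Sum>i<n. us i)) + (\<Sum>i<n. conj_fun (h i) (us i))
            \<le> conj_fun (\<lambda>x. ereal (f x) + g x) (- (\<Sum>i<n. u i)) + (\<Sum>i<n. conj_fun (h i) (u i))"
    and i: "i < n"
  shows "us i = uk i"
proof -
  obtain gk where gk: "g xk = ereal gk"
    using kkt_x g_proper by (cases "g xk") (auto simp: subdiff_def proper_fun_def)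
  have nm: "conj_fun (h i) u \<noteq> -\<infinity>" if "i < n" for i u using h_pcc[OF that] conj_fun_not_MInf by blast
  have "\<exists>b. conj_fun (h i) (uk i) = ereal b" if "i < n" for i
    using nm[OF that, of "uk i"] kkt_u[OF that] by (cases "conj_fun (h i) (uk i)") (auto simp: subdiff_def)
  then obtain b where b: "\<And>i. i < n \<Longrightarrow> conj_fun (h i) (uk i) = ereal (b i)" by metis
  define N where "N = (\<Sum>i<n. (norm (us i - uk i))\<^sup>2)"
  have low: "ereal (\<Sum>i<n. b i + (xk \<bullet> (us i - uk i) + mu_h / 2 * (norm (us i - uk i))\<^sup>2)) \<le> (\<Sum>i<n. conj_fun (h i) (us i))"
    unfolding sum_ereal[symmetric]
  proof (rule sum_mono)
    fix i assume "i \<in> {..<n}"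
    then have i: "i < n" by simp
    show "ereal (b i + (xk \<bullet> (us i - uk i) + mu_h / 2 * (norm (us i - uk i))\<^sup>2)) \<le> conj_fun (h i) (us i)"
      using subdiff_strongly_convex[OF mu_h[OF i] nm[OF i] kkt_u[OF i], of "us i"] by (simp add: b[OF i])
  qed
  have "ereal (- (\<Sum>i<n. us i) \<bullet> xk) - (ereal (f xk) + g xk) \<le> conj_fun (\<lambda>x. ereal (f x) + g x) (- (\<Sum>i<n. us i))"
    by (rule conj_fun_ge)
  then have "ereal (- (\<Sum>i<n. us i) \<bullet> xk - (f xk + gk)) \<le> conj_fun (\<lambda>x. ereal (f x) + g x) (- (\<Sum>i<n. us i))"
    by (simp add: gk)
  from add_mono[OF this low]
  have "ereal (- (\<Sum>i<n. us i) \<bullet> xk - (f xk + gk)) + ereal (\<Sum>i<n. b i + (xk \<bullet> (us i - uk i) + mu_h / 2 * (norm (us i - uk i))\<^sup>2))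
     \<le> conj_fun (\<lambda>x. ereal (f x) + g x) (- (\<Sum>i<n. us i)) + (\<Sum>i<n. conj_fun (h i) (us i))" .
  also have "\<dots> \<le> conj_fun (\<lambda>x. ereal (f x) + g x) (- (\<Sum>i<n. uk i)) + (\<Sum>i<n. conj_fun (h i) (uk i))"
    by (rule sol)
  also have "\<dots> \<le> ereal (- (\<Sum>i<n. uk i) \<bullet> xk - (f xk + gk)) + ereal (\<Sum>i<n. b i)"
  proof (rule add_mono)
    show "conj_fun (\<lambda>x. ereal (f x) + g x) (- (\<Sum>i<n. uk i)) \<le> ereal (- (\<Sum>i<n. uk i) \<bullet> xk - (f xk + gk))"
      unfolding conj_fun_le_iff
    proof
      fix x
      have "0 \<le> (mu_f + mu_g) / 2 * (norm (x - xk))\<^sup>2" using strong by simp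
      then show "ereal (- (\<Sum>i<n. uk i) \<bullet> x) - (ereal (f x) + g x) \<le> ereal (- (\<Sum>i<n. uk i) \<bullet> xk - (f xk + gk))"
        using kkt_lower_bound[OF gk, of x] g_proper
        by (cases "g x") (auto simp: inner_diff_right proper_fun_def)
    qed
    show "(\<Sum>i<n. conj_fun (h i) (uk i)) \<le> ereal (\<Sum>i<n. b i)"
      unfolding sum_ereal[symmetric] by (intro sum_mono) (auto simp: b)
  qed
  finally have "mu_h / 2 * N \<le> 0"
    by (simp add: sum.distrib sum_subtractf inner_diff_right inner_sum_left inner_sum_right inner_commute
        N_def sum_distrib_left)
  then have "N \<le> 0" using strong by (simp add: mult_le_0_iff)
  moreover have "(norm (us i - uk i))\<^sup>2 \<le> N" unfolding N_def using i by (intro member_le_sum) auto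
  ultimately have "(norm (us i - uk i))\<^sup>2 \<le> 0" by linarith
  then show ?thesis by simp
qed

end

section \<open>Transfer of the estimates from the KKT point to the given solutions\<close>

theorem theorem5:
  fixes f :: "'a::euclidean_space \<Rightarrow> real" and df :: "'a \<Rightarrow> 'a"
    and g :: "'a \<Rightarrow> ereal" and h :: "nat \<Rightarrow> 'a \<Rightarrow> ereal"
    and n k :: nat and L mu_f mu_g mu_h \<gamma> :: real
    and x0 xs :: 'a and u0 us :: "nat \<Rightarrow> 'a"
  assumes n: "n \<ge> 2" and k: "1 \<le> k" "k \<le> n"
    and f_convex: "convex_on UNIV f"
    and f_grad: "\<And>x. (f has_derivative (\<lambda>d. df x \<bullet> d)) (at x)"
    and L: "L \<ge> 0" and f_smooth: "\<And>x y. norm (df x - df y) \<le> L * norm (x - y)"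
    and g_pcc: "proper_fun g" "closed_fun g" "convex_fun g"
    and h_pcc: "\<And>i. i < n \<Longrightarrow> proper_fun (h i) \<and> closed_fun (h i) \<and> convex_fun (h i)"
    and mu_f: "mu_f \<ge> 0" "convex_on UNIV (\<lambda>x. f x - mu_f / 2 * (norm x)\<^sup>2)"
    and mu_g: "mu_g \<ge> 0" "strongly_convex_fun mu_g g"
    and mu_h: "mu_h \<ge> 0" "\<And>i. i < n \<Longrightarrow> strongly_convex_fun mu_h (conj_fun (h i))"
    and kkt_exists: "\<exists>xk uk. - (df xk + (\<Sum>i<n. uk i)) \<in> subdiff g xk
                          \<and> (\<forall>i<n. xk \<in> subdiff (conj_fun (h i)) (uk i))"
    and strong: "mu_f > 0 \<or> mu_g > 0" and mu_h_pos: "mu_h > 0"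
    and gamma: "0 < \<gamma>" "\<gamma> * L < 2"
    and xs_primal_sol: "\<And>x. ereal (f xs) + g xs + (\<Sum>i<n. h i xs) \<le> ereal (f x) + g x + (\<Sum>i<n. h i x)"
    and us_dual_sol: "\<And>u. conj_fun (\<lambda>x. ereal (f x) + g x) (- (\<Sum>i<n. us i)) + (\<Sum>i<n. conj_fun (h i) (us i))
                          \<le> conj_fun (\<lambda>x. ereal (f x) + g x) (- (\<Sum>i<n. u i)) + (\<Sum>i<n. conj_fun (h i) (u i))"
  shows
    "let M = sampling_space n k;
         X = (\<lambda>t \<omega>. randprox_x df g h n k \<gamma> x0 u0 (snth \<omega>) t);
         Xh = (\<lambda>t \<omega>. randprox_xhat df g h n k \<gamma> x0 u0 (snth \<omega>) t);
         U = (\<lambda>t \<omega>. randprox_u df g h n k \<gamma> x0 u0 (snth \<omega>) t);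
         Psi = (\<lambda>t \<omega>. 1 / \<gamma> * (norm (X t \<omega> - xs))\<^sup>2
                 + real n / real k * (\<gamma> * real n + 2 * mu_h) * (\<Sum>i<n. (norm (U t \<omega> i - us i))\<^sup>2));
         Psi0 = 1 / \<gamma> * (norm (x0 - xs))\<^sup>2
                 + real n / real k * (\<gamma> * real n + 2 * mu_h) * (\<Sum>i<n. (norm (u0 i - us i))\<^sup>2);
         c = max (max ((1 - \<gamma> * mu_f)\<^sup>2 / (1 + \<gamma> * mu_g)) ((\<gamma> * L - 1)\<^sup>2 / (1 + \<gamma> * mu_g)))
                 (1 - 2 * real k * mu_h / (real n * (\<gamma> * real n + 2 * mu_h)))
     in (\<forall>t. (\<integral>\<^sup>+ \<omega>. ennreal (Psi t \<omega>) \<partial>M) \<le> ennreal (c ^ t * Psi0))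
        \<and> (AE \<omega> in M. (\<lambda>t. X t \<omega>) \<longlonglongrightarrow> xs \<and> (\<lambda>t. Xh t \<omega>) \<longlonglongrightarrow> xs
                      \<and> (\<forall>i<n. (\<lambda>t. U t \<omega> i) \<longlonglongrightarrow> us i))"
proof -
  obtain xk uk where kx: "- (df xk + (\<Sum>i<n. uk i)) \<in> subdiff g xk"
    and ku: "\<And>i. i < n \<Longrightarrow> xk \<in> subdiff (conj_fun (h i)) (uk i)"
    using kkt_exists by blast
  note kkt = f_grad g_pcc(1) h_pcc mu_f(2) mu_g(2) mu_h(2) kx ku
  have "mu_f + mu_g > 0" using strong mu_f(1) mu_g(1) by linarith
  then have xs: "xs = xk" and us: "\<And>i. i < n \<Longrightarrow> us i = uk i"
    using primal_solution_unique[OF kkt _ xs_primal_sol]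
      dual_solution_unique[OF kkt _ mu_h_pos us_dual_sol] by auto
  \<comment> \<open>\<open>us\<close> and \<open>uk\<close> are known to agree only below
    \<open>n\<close>, so the KKT inclusion is transferred through the sum.\<close>
  have "(\<Sum>i<n. us i) = (\<Sum>i<n. uk i)" using us by (intro sum.cong) auto
  then have "- (df xs + (\<Sum>i<n. us i)) \<in> subdiff g xs" using kx xs by simp
  moreover have "\<And>i. i < n \<Longrightarrow> xs \<in> subdiff (conj_fun (h i)) (us i)" using ku xs us by simp
  ultimately interpret R: randprox_kkt f df g h n k L mu_f mu_g mu_h \<gamma> xs us
    using k f_grad f_smooth g_pcc h_pcc mu_f mu_g mu_h strong mu_h_pos gamma
    by unfold_locales auto
  let ?X = "\<lambda>t \<omega>. randprox_x df g h n k \<gamma> x0 u0 (snth \<omega>) t"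
  let ?U = "\<lambda>t \<omega>. randprox_u df g h n k \<gamma> x0 u0 (snth \<omega>) t"
  have xhat: "randprox_xhat df g h n k \<gamma> x0 u0 (snth \<omega>) t = R.xhat (?X t \<omega>) (?U t \<omega>)" for t \<omega>
    by (simp add: randprox_xhat_def R.xhat_def Let_def)
  have at: "R.lyapunov_at x0 u0 t \<omega> = R.lyapunov (?X t \<omega>) (?U t \<omega>)" for t \<omega>
    by (simp add: R.lyapunov_at_def randprox_x_def randprox_u_def)
  have "\<forall>t. (\<integral>\<^sup>+ \<omega>. ennreal (R.lyapunov (?X t \<omega>) (?U t \<omega>)) \<partial>sampling_space n k)
      \<le> ennreal (R.rate ^ t * R.lyapunov x0 u0)"
    using R.expected_lyapunov_le[of x0 u0] by (simp add: at)
  moreover have "AE \<omega> in sampling_space n k. (\<lambda>t. ?X t \<omega>) \<longlonglongrightarrow> xs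
      \<and> (\<lambda>t. randprox_xhat df g h n k \<gamma> x0 u0 (snth \<omega>) t) \<longlonglongrightarrow> xs
      \<and> (\<forall>i<n. (\<lambda>t. ?U t \<omega> i) \<longlonglongrightarrow> us i)"
    using R.AE_lyapunov_tendsto_0[of x0 u0] unfolding at xhat
    by eventually_elim (blast intro: R.convergence_if_lyapunov_tendsto_0)
  ultimately show ?thesis
    unfolding Let_def R.lyapunov_def R.rate_def R.dual_weight_def by (rule conjI)
qed

end
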